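(* For all $z\in\mathbb N\cup\{\infty\}$, $\mathrm{TD}(\mathrm{NC}\Pi^z_{\infty,1})=\mathrm{PBTD}(\mathrm{NC}\Pi^z_{\infty,1})=0$. Suppose $m\ge2$. (i) If $z=1$, then $\mathrm{TD}(\mathrm{NC}\Pi^1_{\infty,m})=\Theta(m)$ and $\mathrm{PBTD}(\mathrm{NC}\Pi^1_{\infty,m})=\Theta(m)$ (as functions of $m$). (ii) For $n\in\mathbb N_0$ let $\omega(n)$ be the number of distinct prime factors of $n$ and let $P(n)$ be the number of prime powers (including primes) not exceeding $n$. If $z\ge2$, then $\max\{\omega(n):n\le m\}\le\mathrm{TD}(\mathrm{NC}\Pi^z_{\infty,m})\le2+P(m-1)$, and $\mathrm{PBTD}(\mathrm{NC}\Pi^z_{\infty,m})=\mathrm{PBTD}(\mathrm{NC}\Pi^z)=1$. In particular, $\max\{\omega(n):n\le m\}\le\mathrm{TD}(\mathrm{NC}\Pi^z_{\infty,m})<O\big((m-1)^{1/2}\log(m-1)\big)+\frac{1.25506(m-1)}{\log(m-1)}$.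
   Context: Fix a countably infinite set $X$ of variables and an alphabet $\Sigma$ (finite or countably infinite, disjoint from $X$), $z=|\Sigma|$. A pattern is a nonempty finite string over $X\cup\Sigma$. A substitution is a morphism $h:(X\cup\Sigma)^*\to\Sigma^*$ fixing letters; $L(\pi)$ (erasing pattern language) is the set of all $h(\pi)$; patterns with equal languages are identified. A non-cross pattern is a constant-free pattern of the form $x_0^{n_0}x_1^{n_1}\cdots x_k^{n_k}$ with distinct variables $x_i$ and $n_i\ge1$. $\mathrm{NC}\Pi^z_{\infty,m}$ is the class of non-cross patterns over an alphabet of size $z$ in which every variable occurs at most $m$ times; $\mathrm{NC}\Pi^z$ is the class of all non-cross patterns. A labelled example is $(w,\pm)$ with $w\in\Sigma^*$; a teaching set for $\pi$ w.r.t. a class $\Pi$ is a set $T$ of labelled examples consistent with $\pi$ such that every $\tau\in\Pi$ consistent with $T$ has $L(\tau)=L(\pi)$; $\mathrm{TD}(\pi,\Pi)$ is its minimum size and $\mathrm{TD}(\Pi)=\sup_{\pi\in\Pi}\mathrm{TD}(\pi,\Pi)$. For a strict partial order $\prec$ on $\Pi$, a teaching set for $\pi$ w.r.t. $(\Pi,\prec)$ is a teaching set for $\pi$ w.r.t. $\Pi\setminus\{\pi':\pi'\prec\pi\}$; $\mathrm{PBTD}(\Pi,\prec)$ is the supremum over $\pi$ of the minimum size of such sets, and $\mathrm{PBTD}(\Pi)=\inf_\prec\mathrm{PBTD}(\Pi,\prec)$. *)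

theory Defs
  imports "HOL-Analysis.Analysis" "HOL-Number_Theory.Number_Theory" "HOL-Library.Extended_Nat"
begin

type_synonym lang = "nat list set"

definition Sig :: "enat \<Rightarrow> nat set" where
  "Sig z = {a. enat a < z}"

text \<open>Constant-free patterns are lists of variables (variables are naturals).
  Erasing pattern language: images under all substitutions h into Sigma^*.\<close>
definition pat_lang :: "nat set \<Rightarrow> nat list \<Rightarrow> lang" where
  "pat_lang S p = {concat (map h p) | h. \<forall>x. h x \<in> lists S}"

definition ncpat :: "nat list \<Rightarrow> nat list" where
  "ncpat ns = concat (map (\<lambda>i. replicate (ns ! i) i) [0..<length ns])"

text \<open>NC Pi^z_{infty,m}, as a set of languages (patterns with equal language identified).\<close>
definition NC_m :: "enat \<Rightarrow> nat \<Rightarrow> lang set" where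
  "NC_m z m = {pat_lang (Sig z) (ncpat ns) | ns. ns \<noteq> [] \<and> (\<forall>n\<in>set ns. 0 < n \<and> n \<le> m)}"

definition NC_all :: "enat \<Rightarrow> lang set" where
  "NC_all z = {pat_lang (Sig z) (ncpat ns) | ns. ns \<noteq> [] \<and> (\<forall>n\<in>set ns. 0 < n)}"

definition esize :: "'a set \<Rightarrow> enat" where
  "esize T = (if finite T then enat (card T) else \<infinity>)"

definition consistent :: "lang \<Rightarrow> (nat list \<times> bool) set \<Rightarrow> bool" where
  "consistent L T \<longleftrightarrow> (\<forall>(w, b) \<in> T. (w \<in> L) = b)"

definition teaching_set :: "nat set \<Rightarrow> lang set \<Rightarrow> lang \<Rightarrow> (nat list \<times> bool) set \<Rightarrow> bool" where
  "teaching_set S C L T \<longleftrightarrow> fst ` T \<subseteq> lists S \<and> consistent L T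
     \<and> (\<forall>L' \<in> C. consistent L' T \<longrightarrow> L' = L)"

definition TD_of :: "nat set \<Rightarrow> lang set \<Rightarrow> lang \<Rightarrow> enat" where
  "TD_of S C L = (INF T \<in> {T. teaching_set S C L T}. esize T)"

definition TD :: "nat set \<Rightarrow> lang set \<Rightarrow> enat" where
  "TD S C = (SUP L \<in> C. TD_of S C L)"

definition strict_po_on :: "lang set \<Rightarrow> (lang \<times> lang) set \<Rightarrow> bool" where
  "strict_po_on C R \<longleftrightarrow> R \<subseteq> C \<times> C \<and> irrefl R \<and> trans R"

definition PBTD_wrt :: "nat set \<Rightarrow> lang set \<Rightarrow> (lang \<times> lang) set \<Rightarrow> enat" where
  "PBTD_wrt S C R = (SUP L \<in> C. TD_of S (C - {L'. (L', L) \<in> R}) L)"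

definition PBTD :: "nat set \<Rightarrow> lang set \<Rightarrow> enat" where
  "PBTD S C = (INF R \<in> {R. strict_po_on C R}. PBTD_wrt S C R)"

definition omega :: "nat \<Rightarrow> nat" where
  "omega n = card (prime_factors n)"

definition Ppow :: "nat \<Rightarrow> nat" where
  "Ppow n = card {q. q \<le> n \<and> primepow q}"

end

theory Submission
  imports Defs "HOL-Real_Asymp.Real_Asymp"
begin

text \<open>
  Over two letters \<open>a, b\<close> the word \<open>(a b^k)^(n_0) (a b^(k-1))^(n_1) \<dots> a^(n_k)\<close> is characteristic: it
  lies in the language of an exponent sequence \<open>ms\<close> without ones only if consecutive disjoint blocks
  of \<open>ms\<close> generate \<open>n_0, \<dots>, n_k\<close> additively, and in that case the language of \<open>ms\<close> contains the whole
  language of \<open>ns\<close>. Hence one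
  positive example suffices when smaller languages are preferred. For the teaching dimension, the
  proper superlanguages are excluded by negative examples: for a prime power \<open>q\<close>, a characteristic
  word with constant exponent not divisible by \<open>q\<close> but by every non-multiple of \<open>q\<close> up to \<open>m\<close> shows
  that \<open>ms\<close> has no more non-multiples of \<open>q\<close> than \<open>ns\<close>. The lower bound distinguishes \<open>x^n\<close> from
  \<open>x^(n/p)\<close> for the primes \<open>p\<close> dividing \<open>n\<close>, and over one letter the submonoids
  \<open>{0} \<union> {2q..3q} \<union> A \<union> {4q..}\<close> with \<open>A \<subseteq> {3q<..<4q}\<close> form a Boolean cube.
\<close>

section \<open>Non-cross languages by recursion on the exponents\<close>

fun pow_lang :: "nat set \<Rightarrow> nat list \<Rightarrow> lang" where
  "pow_lang S [] = {[]}"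
| "pow_lang S (n # ns) = {concat (replicate n u) @ w | u w. u \<in> lists S \<and> w \<in> pow_lang S ns}"

lemma ncpat_Cons: "ncpat (n # ns) = replicate n 0 @ map Suc (ncpat ns)"
proof -
  have "map (\<lambda>i. replicate ((n # ns) ! i) i) [0..<length (n # ns)]
      = replicate n 0 # map (\<lambda>i. map Suc (replicate (ns ! i) i)) [0..<length ns]"
    by (simp add: upt_conv_Cons map_Suc_upt[symmetric] del: upt_Suc)
  then show ?thesis
    unfolding ncpat_def by (simp add: map_concat comp_def)
qed

text \<open>The variables are distinct, so the value of variable 0 can be chosen independently of
  the others. A substitution splits into \<open>h 0\<close> and \<open>h \<circ> Suc\<close>, and
  \<open>case_nat\<close> glues the two parts together again.\<close>

lemma pat_lang_ncpat: "pat_lang S (ncpat ns) = pow_lang S ns"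
proof (induction ns)
  case Nil
  have "\<exists>h :: nat \<Rightarrow> nat list. \<forall>x. h x \<in> lists S"
    by (rule exI[of _ "\<lambda>_. []"]) simp
  then show ?case by (auto simp: pat_lang_def ncpat_def)
next
  case (Cons n ns)
  have eq: "concat (map h (ncpat (n # ns)))
      = concat (replicate n (h 0)) @ concat (map (h \<circ> Suc) (ncpat ns))" for h :: "nat \<Rightarrow> nat list"
    by (simp add: ncpat_Cons)
  show ?case
  proof (intro subset_antisym subsetI)
    fix w assume "w \<in> pat_lang S (ncpat (n # ns))"
    then obtain h where h: "\<forall>x. h x \<in> lists S" "w = concat (map h (ncpat (n # ns)))"
      by (auto simp: pat_lang_def)
    then have "concat (map (h \<circ> Suc) (ncpat ns)) \<in> pow_lang S ns"
      unfolding Cons[symmetric] pat_lang_def by (intro CollectI exI[of _ "h \<circ> Suc"]) (simp add: comp_def)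
    then show "w \<in> pow_lang S (n # ns)" using h eq[of h] by auto
  next
    fix w assume "w \<in> pow_lang S (n # ns)"
    then obtain u v where uv: "u \<in> lists S" "v \<in> pat_lang S (ncpat ns)" "w = concat (replicate n u) @ v"
      by (auto simp: Cons)
    then obtain h where h: "\<forall>x. h x \<in> lists S" "v = concat (map h (ncpat ns))"
      by (auto simp: pat_lang_def)
    have "w = concat (map (case_nat u h) (ncpat (n # ns)))"
      using uv h eq[of "case_nat u h"] by (simp add: comp_def)
    moreover have "\<forall>x. case_nat u h x \<in> lists S"
      using uv h by (auto split: nat.split)
    ultimately show "w \<in> pat_lang S (ncpat (n # ns))" unfolding pat_lang_def by blast
  qed
qed

lemma NC_m_eq: "NC_m z m = {pow_lang (Sig z) ns | ns. ns \<noteq> [] \<and> (\<forall>n\<in>set ns. 0 < n \<and> n \<le> m)}"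
  by (simp add: NC_m_def pat_lang_ncpat)

lemma NC_all_eq: "NC_all z = {pow_lang (Sig z) ns | ns. ns \<noteq> [] \<and> (\<forall>n\<in>set ns. 0 < n)}"
  by (simp add: NC_all_def pat_lang_ncpat)

lemma concat_replicate_lists: "u \<in> lists S \<Longrightarrow> concat (replicate n u) \<in> lists S"
  by (induction n) auto

lemma concat_replicate_mult:
  "concat (replicate (n * r) u) = concat (replicate n (concat (replicate r u)))"
  by (induction n) (simp_all add: replicate_add)

lemma pow_lang_subset_lists: "pow_lang S ns \<subseteq> lists S"
proof (induction ns)
  case (Cons n ns)
  then show ?case using concat_replicate_lists by fastforce
qed simp

lemma Nil_in_pow_lang: "[] \<in> pow_lang S ns"
proof (induction ns)
  case (Cons n ns)
  have "concat (replicate n []) @ [] = ([] :: nat list)" by simp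
  then show ?case using Cons by (auto intro!: exI[of _ "[]"])
qed simp

lemma pow_lang_ConsI:
  "u \<in> lists S \<Longrightarrow> w \<in> pow_lang S ns \<Longrightarrow> concat (replicate n u) @ w \<in> pow_lang S (n # ns)"
  by auto

lemma pow_lang_skip: "w \<in> pow_lang S ns \<Longrightarrow> w \<in> pow_lang S (n # ns)"
  using pow_lang_ConsI[of "[]" S w ns n] by simp

lemma pow_lang_one: "1 \<in> set ns \<Longrightarrow> pow_lang S ns = lists S"
proof (induction ns)
  case (Cons n ns)
  show ?case
  proof (cases "n = 1")
    case True
    have "w \<in> pow_lang S (n # ns)" if "w \<in> lists S" for w
      using pow_lang_ConsI[OF that Nil_in_pow_lang, of n ns] True by simp
    then show ?thesis using pow_lang_subset_lists by blast
  next
    case False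
    then have "pow_lang S ns = lists S" using Cons by auto
    then show ?thesis using pow_lang_skip pow_lang_subset_lists by blast
  qed
qed simp

text \<open>Comparing lengths shows that only an exponent 1 yields a single letter. With
  \<open>pow_lang_one\<close>, a one-letter word then singles out the language of all words.\<close>

lemma singleton_in_pow_langD: "[a] \<in> pow_lang S ns \<Longrightarrow> 1 \<in> set ns"
proof (induction ns)
  case (Cons n ns)
  then obtain u w where uw: "[a] = concat (replicate n u) @ w" "w \<in> pow_lang S ns" by auto
  show ?case
  proof (cases "concat (replicate n u) = []")
    case True
    then show ?thesis using Cons uw by auto
  next
    case False
    then have "concat (replicate n u) = [a]" using uw by (metis append_eq_Cons_conv append_is_Nil_conv)
    then have "length (concat (replicate n u)) = 1" by simp
    then have "n * length u = 1" by (simp add: length_concat sum_list_replicate)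
    then show ?thesis by simp
  qed
qed simp

section \<open>Block embeddings of exponent sequences\<close>

text \<open>\<open>emb ns ms\<close>: there are consecutive disjoint blocks of \<open>ms\<close> such that the \<open>i\<close>-th entry of
  \<open>ns\<close> is a sum of multiples of the entries of the \<open>i\<close>-th block.\<close>
inductive emb :: "nat list \<Rightarrow> nat list \<Rightarrow> bool" where
  emb_Nil: "emb [] ms"
| emb_zero: "emb ns ms \<Longrightarrow> emb (0 # ns) ms"
| emb_use: "emb (n # ns) ms \<Longrightarrow> emb ((n + m * r) # ns) (m # ms)"

text \<open>The rule \<open>emb_use\<close> keeps the current block open, and with
  \<open>r = 0\<close> the new entry contributes nothing to it.\<close>

lemma emb_skip: "emb ns ms \<Longrightarrow> emb ns (m # ms)"
proof (cases ns)
  case (Cons n ns')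
  assume "emb ns ms"
  then show ?thesis using emb_use[of n ns' ms m 0] Cons by simp
qed (simp add: emb_Nil)

lemma emb_drop_head: "emb (n # ns) ms \<Longrightarrow> emb ns ms"
  by (induction "n # ns" ms arbitrary: n ns rule: emb.induct) (auto intro: emb_skip)

lemma emb_add_multiple: "emb ns ms \<Longrightarrow> emb ((m * r) # ns) (m # ms)"
  using emb_use[of 0 ns ms m r] emb_zero by simp

text \<open>The variable with exponent \<open>m\<close> receives \<open>u\<close> repeated
  \<open>r\<close> times and so supplies \<open>m * r\<close> copies of \<open>u\<close>; the other
  \<open>n\<close> copies come from the rest of the block.\<close>

lemma emb_pow_lang: "emb ns ms \<Longrightarrow> pow_lang S ns \<subseteq> pow_lang S ms"
proof (induction rule: emb.induct)
  case (emb_Nil ms)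
  then show ?case by (simp add: Nil_in_pow_lang)
next
  case (emb_zero ns ms)
  then show ?case by auto
next
  case (emb_use n ns ms m r)
  show ?case
  proof
    fix w assume "w \<in> pow_lang S ((n + m * r) # ns)"
    then obtain u v where uv: "u \<in> lists S" "v \<in> pow_lang S ns"
      "w = concat (replicate (m * r + n) u) @ v"
      by (auto simp: add.commute)
    have "w = concat (replicate m (concat (replicate r u))) @ (concat (replicate n u) @ v)"
      using uv(3) by (simp add: replicate_add concat_replicate_mult)
    moreover have "concat (replicate n u) @ v \<in> pow_lang S ms"
      using emb_use.IH pow_lang_ConsI[OF uv(1,2), of n] by blast
    ultimately show "w \<in> pow_lang S (m # ms)"
      using pow_lang_ConsI concat_replicate_lists[OF uv(1)] by metis
  qed
qed

text \<open>A sum of multiples that \<open>q\<close> does not divide involves an entry that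
  \<open>q\<close> does not divide, and the blocks are disjoint. The case \<open>q = 0\<close>
  counts nonzero entries.\<close>

lemma emb_count_not_dvd:
  "emb ns ms \<Longrightarrow> length (filter (\<lambda>n. \<not> q dvd n) ns) \<le> length (filter (\<lambda>n. \<not> q dvd n) ms)"
  by (induction rule: emb.induct) (auto split: if_splits simp: dvd_add_right_iff)

lemma emb_length:
  assumes "emb ns ms" "0 \<notin> set ns"
  shows "length ns \<le> length ms"
proof -
  have "filter (\<lambda>n. \<not> 0 dvd n) ns = ns" using assms(2) by (intro filter_True) (auto intro!: gr0I)
  then show ?thesis
    using emb_count_not_dvd[OF assms(1), of 0] length_filter_le[of "\<lambda>n. \<not> 0 dvd n" ms]
    by (metis le_trans)
qed

text \<open>Equal lengths leave no slack: every block consists of a single entry.\<close>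

lemma emb_same_length:
  assumes "emb ns ms" "0 \<notin> set ns" "length ns = length ms"
  shows "list_all2 (dvd) ms ns"
  using assms
proof (induction ms arbitrary: ns rule: list.induct)
  case (Cons m ms)
  then obtain k ns' where ns: "ns = k # ns'" by (cases ns) auto
  from Cons.prems(1) obtain n r where nr: "k = n + m * r" "emb (n # ns') ms"
    using Cons.prems(2) unfolding ns by (cases rule: emb.cases) auto
  \<comment> \<open>A positive remainder would embed \<open>n # ns'\<close>, which is longer than
    \<open>ms\<close>, into \<open>ms\<close>.\<close>
  have "n = 0"
    using emb_length[OF nr(2)] Cons.prems(2,3) ns by (cases "n = 0") auto
  moreover have "list_all2 (dvd) ms ns'"
    using Cons.IH[OF emb_drop_head[OF nr(2)]] Cons.prems ns by simp
  ultimately show ?case using nr ns by simp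
qed auto

text \<open>A sum below \<open>M\<close> cannot use an entry that is at least \<open>M\<close>. With
  \<open>M = m\<close> this separates off the entries equal to the largest admissible
  exponent.\<close>

lemma emb_filter_less:
  assumes "emb ns ms" "\<forall>n\<in>set ns. n \<le> M" "0 < M"
  shows "emb (filter (\<lambda>n. n < M) ns) (filter (\<lambda>n. n < M) ms)"
  using assms
proof (induction rule: emb.induct)
  case (emb_use n ns ms m r)
  then have IH: "emb (filter (\<lambda>n. n < M) (n # ns)) (filter (\<lambda>n. n < M) ms)" by auto
  show ?case
  proof (cases "n + m * r < M")
    case True
    show ?thesis
    proof (cases "m < M")
      case True
      then show ?thesis using IH \<open>n + m * r < M\<close> by (auto intro: emb.emb_use)
    next
      case False
      then have "r = 0" using True by (cases r) auto
      then show ?thesis using IH False True by auto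
    qed
  next
    case False
    then show ?thesis using IH by (auto split: if_splits intro: emb_skip dest: emb_drop_head)
  qed
qed (auto intro: emb.intros)

text \<open>A partial converse of \<open>emb_count_not_dvd\<close>: each entry that is not a
  multiple of \<open>q\<close> forms a block on its own.\<close>

lemma emb_replicate:
  assumes "\<And>x. x \<in> set ms \<Longrightarrow> \<not> q dvd x \<Longrightarrow> x dvd e"
    and "c \<le> length (filter (\<lambda>x. \<not> q dvd x) ms)"
  shows "emb (replicate c e) ms"
  using assms
proof (induction ms arbitrary: c)
  case (Cons m ms)
  show ?case
  proof (cases c)
    case (Suc c')
    show ?thesis
    proof (cases "q dvd m")
      case True
      then have "emb (replicate c e) ms" using Cons by auto
      then show ?thesis by (rule emb_skip)
    next
      case False
      then obtain r where "e = m * r" using Cons.prems by auto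
      moreover have "emb (replicate c' e) ms" using Cons False Suc by auto
      ultimately show ?thesis using emb_add_multiple Suc by simp
    qed
  qed (simp add: emb_Nil)
qed (simp add: emb_Nil)

section \<open>A characteristic word over two letters\<close>

text \<open>The letters 0 and 1 play the roles of a and b. The list of run lengths determines the
  word and is determined by it, so that words can be handled block by block.\<close>

definition gap_word :: "nat list \<Rightarrow> nat list" where
  "gap_word gs = concat (map (\<lambda>g. 0 # replicate g 1) gs)"

lemma gap_word_simps [simp]:
  "gap_word [] = []"
  "gap_word (g # gs) = 0 # replicate g 1 @ gap_word gs"
  "gap_word (gs @ hs) = gap_word gs @ gap_word hs"
  by (simp_all add: gap_word_def)

lemma gap_word_replicate: "gap_word (replicate k g) = concat (replicate k (0 # replicate g 1))"
  by (simp add: gap_word_def)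

lemma gap_word_concat_replicate:
  "gap_word (concat (replicate k gs)) = concat (replicate k (gap_word gs))"
  by (induction k) simp_all

text \<open>Each variable gets its own run length, and these decrease from left to right;
  \<open>gap_word_power_prefix\<close> exploits this order.\<close>

fun gaps :: "nat list \<Rightarrow> nat list" where
  "gaps [] = []"
| "gaps (n # ns) = replicate n (length ns) @ gaps ns"

definition char_word :: "nat list \<Rightarrow> nat list" where
  "char_word ns = gap_word (gaps ns)"

lemma gaps_less: "g \<in> set (gaps ns) \<Longrightarrow> g < length ns"
  by (induction ns) (auto split: if_splits)

lemma sorted_gaps: "sorted_wrt (\<ge>) (gaps ns)"
proof (induction ns)
  case (Cons n ns)
  have "sorted_wrt (\<ge>) (replicate n (length ns))" by (induction n) auto
  then show ?case using Cons by (auto simp: sorted_wrt_append dest: gaps_less intro: less_imp_le)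
qed simp

lemma char_word_lists: "{0, 1} \<subseteq> S \<Longrightarrow> char_word ns \<in> lists S"
  unfolding char_word_def by (induction "gaps ns" arbitrary: ns) (auto simp: gap_word_def split: if_splits)

lemma char_word_in_pow_lang:
  assumes "{0, 1} \<subseteq> S"
  shows "char_word ns \<in> pow_lang S ns"
proof (induction ns)
  case (Cons n ns)
  have "0 # replicate (length ns) 1 \<in> lists S" using assms by auto
  then show ?case
    using pow_lang_ConsI[OF _ Cons] by (simp add: char_word_def gap_word_replicate)
qed (simp add: char_word_def)

text \<open>The letter 0 occurs only at the start of a block, so a cut in front of a 0 falls between
  two blocks.\<close>

lemma gap_word_split:
  assumes "v @ 0 # y = gap_word gs"
  shows "\<exists>hs ks. gs = hs @ ks \<and> v = gap_word hs \<and> 0 # y = gap_word ks"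
  using assms
proof (induction gs arbitrary: v)
  case (Cons g gs)
  show ?case
  proof (cases v)
    case Nil
    then show ?thesis using Cons.prems by (intro exI[of _ "[]"] exI[of _ "g # gs"]) auto
  next
    case (Cons a v')
    then have a: "a = 0" and eq: "v' @ 0 # y = replicate g 1 @ gap_word gs" using Cons.prems by auto
    obtain us where "v' = replicate g 1 @ us \<and> us @ 0 # y = gap_word gs 
        \<or> v' @ us = replicate g 1 \<and> 0 # y = us @ gap_word gs"
      using eq by (auto simp: append_eq_append_conv2)
    then consider (1) "v' = replicate g 1 @ us" "us @ 0 # y = gap_word gs"
      | (2) "v' @ us = replicate g 1" "0 # y = us @ gap_word gs" by blast
    then show ?thesis
    proof cases
      case 1
      then obtain hs ks where "gs = hs @ ks" "us = gap_word hs" "0 # y = gap_word ks"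
        using Cons.IH[of us] by metis
      then show ?thesis using 1 Cons a by (intro exI[of _ "g # hs"] exI[of _ ks]) auto
    next
      case 2
      \<comment> \<open>Otherwise \<open>us\<close> starts with 0 although it is part of a run of
        ones.\<close>
      have "us = []"
      proof (rule ccontr)
        assume "us \<noteq> []"
        then have "0 \<in> set us" using 2(2) by (cases us) auto
        then have "0 \<in> set (replicate g (1::nat))" using 2(1) by (metis Un_iff set_append)
        then show False by (auto split: if_splits)
      qed
      then show ?thesis using 2 Cons a by (intro exI[of _ "[g]"] exI[of _ gs]) auto
    qed
  qed
qed simp

text \<open>The condition on \<open>rest\<close> keeps the last run of \<open>hs\<close> from being
  prolonged by ones of \<open>rest\<close>, so the blocks match one by one.\<close>

lemma gap_word_prefix:
  assumes "gap_word hs @ rest = gap_word gs" "rest = [] \<or> hd rest = 0"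
  shows "\<exists>ks. gs = hs @ ks \<and> rest = gap_word ks"
  using assms(1)
proof (induction hs arbitrary: gs)
  case (Cons h hs)
  then obtain g gs' where gs: "gs = g # gs'" by (cases gs) auto
  have eq: "replicate h 1 @ (gap_word hs @ rest) = replicate g 1 @ gap_word gs'"
    using Cons.prems gs by simp
  have z: "x = [] \<or> hd x = 0 \<Longrightarrow> y = [] \<or> hd y = 0 \<Longrightarrow>
     replicate h 1 @ x = replicate g 1 @ y \<Longrightarrow> h = g \<and> x = y" for x y :: "nat list" and h g
  proof (induction h arbitrary: g)
    case 0
    then show ?case by (cases g) auto
  next
    case (Suc h)
    then show ?case by (cases g) auto
  qed
  have nz: "gap_word xs = [] \<or> hd (gap_word xs) = 0" for xs by (cases xs) auto
  have "gap_word hs @ rest = [] \<or> hd (gap_word hs @ rest) = 0"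
    using assms(2) by (cases hs) auto
  from z[OF this nz eq] have "h = g" "gap_word hs @ rest = gap_word gs'" by auto
  then show ?case using Cons.IH gs by auto
qed simp

text \<open>Here \<open>rest\<close> might start with ones. By the bound, a run of \<open>hs\<close>
  is never shorter than the run of \<open>ks\<close> that it meets; it cannot be longer either,
  because that run is followed by 0 or by the end of the word.\<close>

lemma gap_word_prefix_bounded:
  assumes "gap_word hs @ rest = gap_word ks" "\<And>h k. h \<in> set hs \<Longrightarrow> k \<in> set ks \<Longrightarrow> k \<le> h"
  shows "\<exists>ls. ks = hs @ ls \<and> rest = gap_word ls"
  using assms
proof (induction hs arbitrary: ks)
  case (Cons h hs)
  then obtain k ks' where ks: "ks = k # ks'" by (cases ks) auto
  then have "k \<le> h" using Cons.prems by auto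
  then obtain d where d: "h = k + d" using le_Suc_ex by blast
  have eq: "replicate d 1 @ (gap_word hs @ rest) = gap_word ks'"
    using Cons.prems(1) ks d by (simp add: replicate_add)
  have "d = 0"
  proof (rule ccontr)
    assume "d \<noteq> 0"
    then show False using eq by (cases d; cases ks') auto
  qed
  then show ?case using Cons.IH[of ks'] Cons.prems eq ks d by auto
qed simp

text \<open>The repeated gaps of a power occur in a non-increasing list of gaps only if they are all equal.\<close>
lemma gap_word_power_prefix:
  assumes sorted: "sorted_wrt (\<ge>) gs" and eq: "concat (replicate m v) @ rest = gap_word gs"
    and "2 \<le> m" "v \<noteq> []"
  shows "\<exists>r ls. gs = replicate (m * r) (hd gs) @ ls \<and> rest = gap_word ls \<and> v = gap_word (replicate r (hd gs))"
proof -
  obtain k where m: "m = Suc (Suc k)" using \<open>2 \<le> m\<close> by (metis Suc_le_D numeral_2_eq_2 Suc_le_mono)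
  obtain v' where v': "v = 0 # v'"
    using eq m \<open>v \<noteq> []\<close> by (cases v; cases gs) auto
  have cr: "concat (replicate (Suc k) v) @ v = concat (replicate m v)"
    using m by (metis concat.simps(2) concat_append append_Nil2 concat.simps(1) replicate_Suc replicate_append_same)
  obtain hs ks where hs: "gs = hs @ ks" "v = gap_word hs" "concat (replicate (Suc k) v) @ rest = gap_word ks"
  proof -
    \<comment> \<open>The second copy of \<open>v\<close> starts with 0, so the first copy consists
      of whole blocks.\<close>
    have "v @ 0 # v' @ concat (replicate k v) @ rest = gap_word gs" using eq m v' by simp
    from gap_word_split[OF this] show ?thesis using that v'
      by (metis append_Cons append_assoc concat.simps(2) replicate_Suc)
  qed
  have "hs \<noteq> []" using hs(2) \<open>v \<noteq> []\<close> by auto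
  \<comment> \<open>All copies but the last are followed by another copy and hence by 0. The last
    one is treated by the bounded version.\<close>
  have "gap_word (concat (replicate (Suc k) hs)) @ (v @ rest) = gap_word gs"
    using eq cr hs(2) by (simp add: gap_word_concat_replicate flip: append_assoc)
  then obtain ks' where ks': "gs = concat (replicate (Suc k) hs) @ ks'" "gap_word hs @ rest = gap_word ks'"
    using gap_word_prefix[of "concat (replicate (Suc k) hs)" "v @ rest" gs] v' hs(2) by auto
  \<comment> \<open>The list \<open>hs\<close> occurs in the earlier copies, ahead of all of
    \<open>ks'\<close>. Since \<open>ks'\<close> turns out to start with \<open>hs\<close> again,
    all entries of \<open>hs\<close> coincide.\<close>
  have le: "y \<le> x" if "x \<in> set hs" "y \<in> set ks'" for x y
    using sorted that unfolding ks'(1) by (auto simp: sorted_wrt_append)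
  obtain ls where ls: "ks' = hs @ ls" "rest = gap_word ls"
    using gap_word_prefix_bounded[OF ks'(2) le] by auto
  have "x = hd gs" if "x \<in> set hs" for x
  proof -
    have "hd gs = hd hs" using ks'(1) \<open>hs \<noteq> []\<close> by simp
    moreover have "hd hs \<le> x" using le[OF that] ls \<open>hs \<noteq> []\<close> by simp
    moreover have "x \<le> hd hs" using le[of "hd hs" x] that ls \<open>hs \<noteq> []\<close> by simp
    ultimately show ?thesis by simp
  qed
  then have rep: "hs = replicate (length hs) (hd gs)" by (metis replicate_eqI)
  have cc: "concat (replicate (Suc k) hs) @ hs = concat (replicate m hs)"
    using m by (metis concat.simps(2) concat_append append_Nil2 concat.simps(1) replicate_Suc replicate_append_same)
  have "gs = concat (replicate m hs) @ ls" using ks'(1) ls(1) cc by (metis append_assoc)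
  also have "concat (replicate m hs) = replicate (m * length hs) (hd gs)"
    by (subst rep) (induction m, simp_all add: replicate_add)
  finally show ?thesis using ls(2) hs(2) rep by metis
qed

lemma replicate_append_bounded:
  assumes "replicate n (c::nat) @ xs = replicate k c @ ys" "c \<notin> set xs"
  shows "k \<le> n \<and> ys = replicate (n - k) c @ xs"
  using assms
proof (induction k arbitrary: n)
  case (Suc k)
  then show ?case by (cases n) auto
qed simp

text \<open>If the first variable of \<open>ms\<close> has a nonempty value, its power is a prefix
  made of \<open>m * r\<close> equal blocks, all belonging to the first nonzero exponent of
  \<open>ns\<close>. Removing them leaves a characteristic word with that exponent lowered, as in
  \<open>emb_use\<close>.\<close>

lemma char_word_in_pow_langD:
  assumes "char_word ns \<in> pow_lang S ms" "\<forall>m\<in>set ms. 2 \<le> m"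
  shows "emb ns ms"
  using assms
proof (induction ms arbitrary: ns)
  case Nil
  then have "gap_word (gaps ns) = []" by (simp add: char_word_def)
  then have "gaps ns = []" by (cases "gaps ns") auto
  then have "emb ns []" by (induction ns) (auto intro: emb.intros)
  then show ?case .
next
  case (Cons m ms)
  from Cons.prems obtain v rest where vr: "char_word ns = concat (replicate m v) @ rest" 
    "rest \<in> pow_lang S ms" by auto
  have m2: "2 \<le> m" using Cons.prems by auto
  have IH: "emb ns' ms" if "char_word ns' \<in> pow_lang S ms" for ns' using Cons that by simp
  show ?case
  proof (cases "v = []")
    case True
    then have "char_word ns \<in> pow_lang S ms" using vr by simp
    then show ?thesis using Cons emb_skip by simp
  next
    case False
    from vr(1) show ?thesis
    \<comment> \<open>Leading zero exponents contribute no blocks; this induction strips them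
      off.\<close>
    proof (induction ns)
      case Nil
      then show ?case by (simp add: emb_Nil)
    next
      case (Cons n ns')
      show ?case
      proof (cases "n = 0")
        case True
        then show ?thesis using Cons by (simp add: char_word_def emb_zero)
      next
        case n0: False
        then have hd: "hd (gaps (n # ns')) = length ns'" by (cases n) auto
        obtain r ls where r: "gaps (n # ns') = replicate (m * r) (length ns') @ ls" "rest = gap_word ls"
          using gap_word_power_prefix[OF sorted_gaps, of m v rest "n # ns'"] Cons.prems m2 False hd
          by (auto simp: char_word_def)
        have "length ns' \<notin> set (gaps ns')" using gaps_less by blast
        then have le: "m * r \<le> n" and ls: "ls = replicate (n - m * r) (length ns') @ gaps ns'"
          using replicate_append_bounded[of n "length ns'" "gaps ns'" "m * r" ls] r by auto
        have "rest = char_word ((n - m * r) # ns')" using ls r by (simp add: char_word_def)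
        then have "emb ((n - m * r) # ns') ms" 
          using IH vr(2) by simp
        then show ?thesis using emb_use[of "n - m * r" ns' ms m r] le by simp
      qed
    qed
  qed
qed

section \<open>Teaching dimensions\<close>

lemma TD_of_le:
  assumes "teaching_set S C L T" "finite T" "card T \<le> k"
  shows "TD_of S C L \<le> enat k"
proof -
  have "TD_of S C L \<le> esize T" unfolding TD_of_def using assms(1) by (intro INF_lower) auto
  also have "\<dots> \<le> enat k" using assms by (simp add: esize_def)
  finally show ?thesis .
qed

lemma TD_of_ge:
  assumes "\<And>T. teaching_set S C L T \<Longrightarrow> finite T \<Longrightarrow> k \<le> card T"
  shows "enat k \<le> TD_of S C L"
  unfolding TD_of_def using assms by (intro INF_greatest) (auto simp: esize_def)

text \<open>The empty order discards no competitor.\<close>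

lemma PBTD_le_TD: "PBTD S C \<le> TD S C"
proof -
  have "PBTD S C \<le> PBTD_wrt S C {}"
    unfolding PBTD_def by (intro INF_lower) (auto simp: strict_po_on_def irrefl_def)
  then show ?thesis by (simp add: PBTD_wrt_def TD_def)
qed

text \<open>By asymmetry, at least one of the two languages keeps the other as a competitor, and the
  empty set does not separate them.\<close>

lemma PBTD_ge_one:
  assumes "L1 \<in> C" "L2 \<in> C" "L1 \<noteq> L2"
  shows "1 \<le> PBTD S C"
  unfolding PBTD_def
proof (intro INF_greatest)
  fix R assume "R \<in> {R. strict_po_on C R}"
  then have R: "strict_po_on C R" by simp
  have "\<not> ((L2, L1) \<in> R \<and> (L1, L2) \<in> R)"
    using R unfolding strict_po_on_def irrefl_def by (meson transE)
  then obtain A B where AB: "A \<in> C" "B \<in> C" "A \<noteq> B" "(B, A) \<notin> R" using assms by metis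
  have "1 \<le> card T" if "teaching_set S (C - {L'. (L', A) \<in> R}) A T" "finite T" for T
  proof -
    have "T \<noteq> {}" using that(1) AB by (auto simp: teaching_set_def consistent_def)
    then show ?thesis using that(2) by (simp add: Suc_le_eq card_gt_0_iff)
  qed
  then have "enat 1 \<le> TD_of S (C - {L'. (L', A) \<in> R}) A" by (rule TD_of_ge)
  also have "\<dots> \<le> PBTD_wrt S C R" unfolding PBTD_wrt_def using AB(1) by (intro SUP_upper)
  finally show "1 \<le> PBTD_wrt S C R" by (simp add: one_enat_def)
qed

lemma NC_m_one: "NC_m z 1 = {lists (Sig z)}"
proof -
  have "pow_lang (Sig z) ns = lists (Sig z)" if "ns \<noteq> []" "\<forall>n\<in>set ns. 0 < n \<and> n \<le> 1" for ns
  proof -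
    have "1 \<in> set ns" using that by (cases ns) (auto simp: le_Suc_eq)
    then show ?thesis by (rule pow_lang_one)
  qed
  moreover have "lists (Sig z) = pow_lang (Sig z) [1]" by (rule pow_lang_one[symmetric]) simp
  moreover have "[1::nat] \<noteq> []" "\<forall>n\<in>set [1::nat]. 0 < n \<and> n \<le> 1" by auto
  ultimately show ?thesis unfolding NC_m_eq by blast
qed

lemma TD_NC_m_one: "TD (Sig z) (NC_m z 1) = 0"
proof -
  have "TD_of (Sig z) {lists (Sig z)} (lists (Sig z)) \<le> enat 0"
    by (rule TD_of_le[of _ _ _ "{}"]) (auto simp: teaching_set_def consistent_def)
  then show ?thesis unfolding NC_m_one TD_def by (simp flip: zero_enat_def)
qed

section \<open>Preference-based teaching over at least two letters\<close>

lemma Sig_ge_two: "2 \<le> z \<Longrightarrow> {0, 1} \<subseteq> Sig z"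
proof -
  assume "2 \<le> z"
  then have "enat 1 < z" "enat 0 < z"
    by (cases z; simp add: numeral_eq_enat)+
  then show ?thesis by (simp add: Sig_def)
qed

lemma NC_all_cases:
  assumes "L \<in> NC_all z"
  obtains "L = lists (Sig z)" | ns where "L = pow_lang (Sig z) ns" "\<forall>n\<in>set ns. 2 \<le> n"
proof -
  obtain ns where ns: "L = pow_lang (Sig z) ns" "\<forall>n\<in>set ns. 0 < n"
    using assms by (auto simp: NC_all_eq)
  show ?thesis
  proof (cases "1 \<in> set ns")
    case True
    then show ?thesis using that(1) ns pow_lang_one by blast
  next
    case False
    then have "\<forall>n\<in>set ns. 2 \<le> n" using ns(2) by (metis One_nat_def Suc_1 Suc_leI le_neq_implies_less)
    then show ?thesis using that(2) ns by blast
  qed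
qed

lemma NC_m_subset_NC_all: "NC_m z m \<subseteq> NC_all z"
  by (auto simp: NC_m_eq NC_all_eq)

text \<open>The order discards the proper superlanguages of \<open>L\<close>. It then suffices to
  show a word of \<open>L\<close> whose presence forces a language to contain \<open>L\<close>:
  \<open>[0]\<close> if \<open>L\<close> consists of all words, and the characteristic word
  otherwise.\<close>

lemma PBTD_le_one:
  assumes "2 \<le> z" "C \<subseteq> NC_all z"
  shows "PBTD (Sig z) C \<le> 1"
proof -
  let ?S = "Sig z"
  let ?R = "{(L', L). L' \<in> C \<and> L \<in> C \<and> L \<subset> L'}"
  note S01 = Sig_ge_two[OF assms(1)]
  have "strict_po_on C ?R"
    unfolding strict_po_on_def irrefl_def trans_def by auto
  then have "PBTD ?S C \<le> PBTD_wrt ?S C ?R" unfolding PBTD_def by (intro INF_lower) auto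
  also have "\<dots> \<le> 1"
    unfolding PBTD_wrt_def
  proof (intro SUP_least)
    fix L assume L: "L \<in> C"
    have "\<exists>w\<in>lists ?S. w \<in> L \<and> (\<forall>L'\<in>C. w \<in> L' \<longrightarrow> L \<subseteq> L')"
    proof -
      have "L \<in> NC_all z" using L assms by auto
      then show ?thesis
      proof (cases rule: NC_all_cases)
        case 1
        have "[0] \<in> lists ?S" using S01 by auto
        moreover have "L \<subseteq> L'" if "L' \<in> C" "[0] \<in> L'" for L'
        proof -
          have "L' \<in> NC_all z" using that assms by auto
          then show ?thesis
          proof (cases rule: NC_all_cases)
            case (2 ns)
            then show ?thesis using that singleton_in_pow_langD[of 0 ?S ns] by auto
          qed (use 1 in auto)
        qed
        ultimately show ?thesis using 1 by blast
      next
        case (2 ns)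
        have "L \<subseteq> L'" if "L' \<in> C" "char_word ns \<in> L'" for L'
        proof -
          have "L' \<in> NC_all z" using that assms by auto
          then show ?thesis
          proof (cases rule: NC_all_cases)
            case 1
            then show ?thesis using 2 pow_lang_subset_lists by simp
          next
            case (2 ms)
            then have "emb ns ms" using char_word_in_pow_langD that by blast
            then show ?thesis using 2 \<open>L = pow_lang ?S ns\<close> emb_pow_lang by simp
          qed
        qed
        then show ?thesis using char_word_in_pow_lang[OF S01, of ns] char_word_lists[OF S01, of ns] 2 by blast
      qed
    qed
    then obtain w where w: "w \<in> lists ?S" "w \<in> L" "\<forall>L'\<in>C. w \<in> L' \<longrightarrow> L \<subseteq> L'" by blast
    have "teaching_set ?S (C - {L'. (L', L) \<in> ?R}) L {(w, True)}"
      using w L by (auto simp: teaching_set_def consistent_def)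
    then have "TD_of ?S (C - {L'. (L', L) \<in> ?R}) L \<le> enat 1" by (rule TD_of_le) auto
    then show "TD_of ?S (C - {L'. (L', L) \<in> ?R}) L \<le> 1" by (simp add: one_enat_def)
  qed
  finally show ?thesis .
qed

text \<open>The word \<open>[0]\<close> separates the patterns x and x^2, so the dimension is
  positive. Both the bounded and the unbounded class are instances of \<open>C\<close>.\<close>

lemma PBTD_eq_one:
  assumes "2 \<le> z" "2 \<le> m" "NC_m z m \<subseteq> C" "C \<subseteq> NC_all z"
  shows "PBTD (Sig z) C = 1"
proof -
  have "pow_lang (Sig z) [1] \<in> NC_m z m" "pow_lang (Sig z) [2] \<in> NC_m z m"
    unfolding NC_m_eq using assms(2) by (force simp del: pow_lang.simps)+
  moreover have "[0] \<in> pow_lang (Sig z) [1]"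
    using pow_lang_one[of "[1]" "Sig z"] Sig_ge_two[OF assms(1)] by auto
  moreover have "[0] \<notin> pow_lang (Sig z) [2]"
    using singleton_in_pow_langD[of 0 "Sig z" "[2]"] by auto
  ultimately have "1 \<le> PBTD (Sig z) C"
    using assms(3) by (intro PBTD_ge_one[of "pow_lang (Sig z) [1]" _ "pow_lang (Sig z) [2]"]) blast+
  then show ?thesis using PBTD_le_one[OF assms(1,4)] by simp
qed

section \<open>Lower bound for the teaching dimension\<close>

lemma commuting_append_eq_power:
  assumes "t @ x = x @ t" "length x = k * length t"
  shows "x = concat (replicate k t)"
  using assms
proof (induction k arbitrary: x)
  case (Suc k)
  have "take (length t) (t @ x) = take (length t) (x @ t)" using Suc.prems(1) by simp
  then have "t = take (length t) x" using Suc.prems(2) by simp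
  then obtain x' where x': "x = t @ x'" by (metis append_take_drop_id)
  then show ?case using Suc.IH[of x'] Suc.prems by simp
qed simp

text \<open>Invariance under rotation by \<open>d\<close> says that the prefix of length
  \<open>d\<close> commutes with the rest of the word.\<close>

lemma rotate_eq_self_imp_power:
  assumes "rotate d w = w" "length w = k * d" "0 < d"
  shows "w = concat (replicate k (take d w))"
proof (cases k)
  case (Suc j)
  have "drop d w @ take d w = w"
    using assms Suc by (cases "j = 0") (auto simp: rotate_drop_take)
  then have "take d w @ drop d w = drop d w @ take d w" by simp
  moreover have "length (drop d w) = j * length (take d w)" using assms Suc by simp
  ultimately have "drop d w = concat (replicate j (take d w))" by (rule commuting_append_eq_power)
  then have "take d w @ drop d w = concat (replicate k (take d w))" using Suc by simp
  then show ?thesis by simp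
qed (use assms in simp)

lemma rotate_power: "rotate (length u * x) (concat (replicate a u)) = concat (replicate a u)"
proof (induction x)
  case (Suc x)
  have "rotate (length u) (concat (replicate a u)) = concat (replicate a u)"
  proof (cases a)
    case (Suc b)
    have "concat (replicate b u) @ u = concat (replicate (Suc b) u)"
      by (metis append_Nil2 concat.simps(1,2) concat_append replicate_Suc replicate_append_same)
    then show ?thesis using Suc rotate_append[of u "concat (replicate b u)"] by simp
  qed simp
  then show ?case using Suc by (simp add: add.commute flip: rotate_rotate)
qed simp

text \<open>The common word is invariant under rotation by the lengths of \<open>u\<close> and
  \<open>v\<close>, hence by their gcd \<open>d\<close>, and it consists of exactly
  \<open>lcm a b\<close> pieces of length \<open>d\<close>.\<close>

lemma power_word_lcm:
  assumes eq: "concat (replicate a u) = concat (replicate b v)" 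
  shows "\<exists>t. set t \<subseteq> set u \<and> concat (replicate a u) = concat (replicate (lcm a b) t)"
proof (cases "concat (replicate a u) = []")
  case True
  then show ?thesis by (intro exI[of _ "[]"]) simp
next
  case False
  define w where "w = concat (replicate a u)"
  have pos: "a > 0" "b > 0" "u \<noteq> []" "v \<noteq> []" using False assms by (auto intro!: gr0I)
  define d where "d = gcd (length u) (length v)"
  have lu: "length w = a * length u"
    unfolding w_def by (simp add: length_concat sum_list_replicate)
  have lv: "length w = b * length v"
    unfolding w_def eq by (simp add: length_concat sum_list_replicate)
  \<comment> \<open>By Bezout, a rotation by a multiple of the length of \<open>v\<close>, followed
    by one by \<open>d\<close>, is a rotation by a multiple of the length of
    \<open>u\<close>.\<close>
  obtain x y where xy: "length u * x = length v * y + d"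
    using bezout_nat[of "length u" "length v"] pos d_def by auto
  have "rotate d w = rotate d (rotate (length v * y) w)" unfolding w_def eq by (simp only: rotate_power)
  also have "\<dots> = rotate (length u * x) w" using xy by (simp add: rotate_rotate add.commute)
  also have "\<dots> = w" unfolding w_def by (rule rotate_power)
  finally have rot: "rotate d w = w" .
  have "d > 0" using pos d_def by simp
  have "lcm a b * d = length w"
  proof (rule dvd_antisym)
    have "length w dvd lcm a b * length u" unfolding lu by (rule mult_dvd_mono) auto
    moreover have "length w dvd lcm a b * length v" unfolding lv by (rule mult_dvd_mono) auto
    ultimately have "length w dvd gcd (lcm a b * length u) (lcm a b * length v)" by simp
    then show "length w dvd lcm a b * d" unfolding d_def by (simp only: gcd_mult_distrib_nat)
    obtain u' v' where uv: "length u = d * u'" "length v = d * v'"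
      unfolding d_def by (meson dvd_def gcd_dvd1 gcd_dvd2)
    then have "d * (a * u') = d * (b * v')" using lu lv by (metis mult.left_commute)
    then have "a * u' = b * v'" using \<open>d > 0\<close> by simp
    then have "lcm a b dvd a * u'" by (metis dvd_triv_left lcm_least)
    then show "lcm a b * d dvd length w" using lu uv by (simp add: mult.left_commute mult.commute)
  qed
  then have "w = concat (replicate (lcm a b) (take d w))"
    using rotate_eq_self_imp_power[OF rot _ \<open>d > 0\<close>] by metis
  moreover have "set (take d w) \<subseteq> set u"
    using set_take_subset[of d w] unfolding w_def by (auto split: if_splits)
  ultimately show ?thesis unfolding w_def by metis
qed

text \<open>Each x^(n/p) has a proper superlanguage of that of x^n and must be refuted by a negative
  example. Two primes p and q cannot share one: it would be a power with exponent lcm(n/p, n/q) =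
  n.\<close>

lemma TD_NC_m_ge_omega:
  assumes "0 \<in> Sig z" "n \<le> m"
  shows "enat (omega n) \<le> TD (Sig z) (NC_m z m)"
proof (cases "n = 0")
  case True
  \<comment> \<open>The set \<open>prime_factors 0\<close> is empty, so
    \<open>omega 0 = 0\<close>.\<close>
  then show ?thesis by (simp add: omega_def flip: zero_enat_def)
next
  case False
  let ?S = "Sig z"
  let ?L = "\<lambda>k. pow_lang (Sig z) [k]"
  have memI: "?L k \<in> NC_m z m" if "0 < k" "k \<le> m" for k
  proof -
    have "[k] \<noteq> []" "\<forall>n\<in>set [k]. 0 < n \<and> n \<le> m" using that by auto
    then show ?thesis unfolding NC_m_eq by blast
  qed
  have Lk: "w \<in> ?L k \<longleftrightarrow> (\<exists>u\<in>lists ?S. w = concat (replicate k u))" for w k by auto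
  have "omega n \<le> card T" if T: "teaching_set ?S (NC_m z m) (?L n) T" "finite T" for T
  proof -
    have ex: "\<exists>w. (w, False) \<in> T \<and> w \<in> ?L (n div p) \<and> w \<notin> ?L n" if p: "p \<in> prime_factors n" for p
    proof -
      have "p dvd n" "prime p" using p by auto
      then obtain k where k: "n = p * k" by auto
      have "n div p = k" using k \<open>prime p\<close> by (simp add: prime_gt_0_nat)
      have k0: "0 < k" "k \<le> n" "k < n" using k False prime_gt_1_nat[OF \<open>prime p\<close>] by (auto intro: gr0I)
      have sub: "?L n \<subseteq> ?L k"
        using emb_pow_lang[OF emb_add_multiple[OF emb_Nil, of k p "[]"]] k by (simp add: mult.commute)
      have "replicate k 0 \<in> ?L k"
        unfolding Lk using assms(1) by (intro bexI[of _ "[0]"]) (induction k, simp_all)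
      moreover have "replicate k 0 \<notin> ?L n"
      proof
        assume "replicate k 0 \<in> ?L n"
        then obtain u :: "nat list" where "replicate k 0 = concat (replicate n u)" unfolding Lk by blast
        then have "length (replicate k (0::nat)) = length (concat (replicate n u))" by (rule arg_cong)
        then have "k = n * length u" by (simp add: length_concat sum_list_replicate)
        then show False using k0 by (metis dvd_triv_left nat_dvd_not_less)
      qed
      ultimately have "?L k \<noteq> ?L n" by blast
      moreover have "?L k \<in> NC_m z m" using k0 assms by (intro memI) auto
      ultimately have "\<not> consistent (?L k) T" using T(1) unfolding teaching_set_def by blast
      then obtain w b where wb: "(w, b) \<in> T" "(w \<in> ?L k) \<noteq> b" unfolding consistent_def by auto
      have "(w \<in> ?L n) = b" using T(1) wb(1) unfolding teaching_set_def consistent_def by blast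
      then have "w \<in> ?L k" "w \<notin> ?L n" "b = False" using wb sub by (cases b; blast)+
      then show ?thesis using wb(1) \<open>n div p = k\<close> by blast
    qed
    then obtain f where f: "\<And>p. p \<in> prime_factors n \<Longrightarrow> (f p, False) \<in> T \<and> f p \<in> ?L (n div p) \<and> f p \<notin> ?L n"
      by metis
    have "inj_on (\<lambda>p. (f p, False)) (prime_factors n)"
    proof (rule inj_onI, rule ccontr)
      fix p q assume pq: "p \<in> prime_factors n" "q \<in> prime_factors n" "(f p, False) = (f q, False)" "p \<noteq> q"
      obtain u where u: "u \<in> lists ?S" "f p = concat (replicate (n div p) u)"
        using f[OF pq(1)] Lk by blast
      obtain v where v: "f q = concat (replicate (n div q) v)" using f[OF pq(2)] Lk by blast
      have "f p = f q" using pq(3) by simp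
      then obtain t where t: "set t \<subseteq> set u" "f p = concat (replicate (lcm (n div p) (n div q)) t)"
        using power_word_lcm[of "n div p" u "n div q" v] u v by auto
      have "coprime p q" using pq by (intro primes_coprime) auto
      have "n dvd lcm (n div p) (n div q)"
      proof -
        have "p * q dvd n" using pq \<open>coprime p q\<close> by (intro divides_mult) auto
        then obtain k where k: "n = p * q * k" by auto
        have "p > 0" "q > 0" using pq by (auto intro: prime_gt_0_nat)
        then have "n div p = k * q" "n div q = k * p" using k by (simp_all add: mult.commute mult.left_commute)
        then have "lcm (n div p) (n div q) = k * (p * q)"
          using \<open>coprime p q\<close> by (simp add: lcm_mult_left lcm_coprime coprime_commute mult.commute)
        then show ?thesis using k by (simp add: mult.commute)
      qed
      then obtain r where "lcm (n div p) (n div q) = n * r" by auto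
      then have "f p = concat (replicate n (concat (replicate r t)))"
        using t by (simp add: concat_replicate_mult)
      moreover have "concat (replicate r t) \<in> lists ?S" 
        using u(1) t(1) by (intro concat_replicate_lists) auto
      ultimately show False using f[OF pq(1)] Lk by blast
    qed
    then have "card (prime_factors n) \<le> card T"
      using f T(2) by (intro card_inj_on_le) auto
    then show ?thesis by (simp add: omega_def)
  qed
  then have "enat (omega n) \<le> TD_of ?S (NC_m z m) (?L n)" by (rule TD_of_ge)
  also have "\<dots> \<le> TD ?S (NC_m z m)"
    unfolding TD_def using memI[of n] False assms by (intro SUP_upper) auto
  finally show ?thesis .
qed

section \<open>Upper bound for the teaching dimension\<close>

text \<open>The multiplicity of a prime in an lcm is the larger of the two multiplicities. Arbitrary
  \<open>q\<close> would fail: 6 divides the lcm of 2 and 3.\<close>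

lemma primepow_dvd_lcmD:
  assumes "primepow (q::nat)" "q dvd lcm a b" "0 < a" "0 < b"
  shows "q dvd a \<or> q dvd b"
proof -
  obtain p k where pk: "prime p" "q = p ^ k" using assms(1) by (auto simp: primepow_def)
  then have "k \<le> multiplicity p (lcm a b)"
    using assms by (intro multiplicity_geI) (auto simp: lcm_eq_0_iff prime_gt_1_nat)
  then have "k \<le> max (multiplicity p a) (multiplicity p b)"
    using assms pk by (simp add: multiplicity_lcm)
  then show ?thesis unfolding pk(2) by (auto simp: le_max_iff_disj intro: multiplicity_dvd')
qed

lemma primepow_dvd_LcmD:
  assumes "finite A" "primepow (q::nat)" "q dvd Lcm A" "\<And>a. a \<in> A \<Longrightarrow> 0 < a"
  shows "\<exists>a\<in>A. q dvd a"
  using assms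
proof (induction A rule: finite_induct)
  case empty
  then show ?case using primepow_gt_Suc_0[of q] by auto
next
  case (insert a A)
  have "0 \<notin> A" using insert.prems(3) by blast
  then have "0 < Lcm A" using insert.hyps by (metis Lcm_0_iff_nat gr0I)
  moreover have "0 < a" using insert.prems(3) by simp
  ultimately have "q dvd a \<or> q dvd Lcm A"
    using insert.prems(1,2) primepow_dvd_lcmD[of q a "Lcm A"] by simp
  then show ?case using insert.IH insert.prems by blast
qed

text \<open>The only multiple of \<open>q = 0\<close> is \<open>0\<close>, so \<open>ncount 0\<close> is the length of a list of positive entries.\<close>
abbreviation ncount :: "nat \<Rightarrow> nat list \<Rightarrow> nat" where
  "ncount q ns \<equiv> length (filter (\<lambda>n. \<not> q dvd n) ns)"

definition test_exp :: "nat \<Rightarrow> nat \<Rightarrow> nat" where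
  "test_exp m q = Lcm {x \<in> {1..m}. \<not> q dvd x}"

lemma not_dvd_test_exp:
  assumes "q = 0 \<or> primepow q"
  shows "\<not> q dvd test_exp m q"
proof (cases "q = 0")
  case True
  then show ?thesis by (simp add: test_exp_def Lcm_0_iff)
next
  case False
  then show ?thesis using assms primepow_dvd_LcmD[of "{x \<in> {1..m}. \<not> q dvd x}" q]
    unfolding test_exp_def by auto
qed

lemma dvd_test_exp: "0 < x \<Longrightarrow> x \<le> m \<Longrightarrow> \<not> q dvd x \<Longrightarrow> x dvd test_exp m q"
  unfolding test_exp_def by (intro dvd_Lcm) auto

text \<open>One repetition more than \<open>ns\<close> has non-multiples of \<open>q\<close> makes
  this a negative example for \<open>ns\<close>.\<close>

definition test_word :: "nat \<Rightarrow> nat \<Rightarrow> nat list \<Rightarrow> nat list" where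
  "test_word m q ns = char_word (replicate (Suc (ncount q ns)) (test_exp m q))"

lemma test_word_in_pow_lang_iff:
  assumes "{0, 1} \<subseteq> S" "q = 0 \<or> primepow q" "\<forall>n\<in>set ms. 2 \<le> n \<and> n \<le> m"
  shows "test_word m q ns \<in> pow_lang S ms \<longleftrightarrow> ncount q ns < ncount q ms"
proof
  assume "test_word m q ns \<in> pow_lang S ms"
  then have "emb (replicate (Suc (ncount q ns)) (test_exp m q)) ms"
    using assms char_word_in_pow_langD unfolding test_word_def by blast
  from emb_count_not_dvd[OF this, of q] show "ncount q ns < ncount q ms"
    using not_dvd_test_exp[OF assms(2)] by simp
next
  assume "ncount q ns < ncount q ms"
  then have "emb (replicate (Suc (ncount q ns)) (test_exp m q)) ms"
    using assms(3) by (intro emb_replicate[of ms q] dvd_test_exp) force+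
  then show "test_word m q ns \<in> pow_lang S ms"
    using emb_pow_lang char_word_in_pow_lang[OF assms(1)] unfolding test_word_def by blast
qed

lemma list_all2_dvd_ncount:
  assumes "list_all2 (dvd) ms ns"
  shows "ncount q ns \<le> ncount q ms"
  using assms by (induction rule: list_all2_induct) (auto intro: dvd_trans)

text \<open>From \<open>ms\<close> to \<open>ns\<close>, a position can only change from a
  non-multiple of \<open>q\<close> to a multiple, so equal counts rule out any change.\<close>

lemma list_all2_dvd_ncount_eq:
  assumes "list_all2 (dvd) ms ns" "ncount q ms \<le> ncount q ns"
  shows "list_all2 (\<lambda>x y. q dvd y \<longrightarrow> q dvd x) ms ns"
  using assms
proof (induction rule: list_all2_induct)
  case (Cons x xs y ys)
  have le: "ncount q ys \<le> ncount q xs" using Cons.hyps list_all2_dvd_ncount by blast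
  have "q dvd x \<longrightarrow> q dvd y" using Cons.hyps dvd_trans by blast
  then show ?case using Cons le by (auto split: if_splits)
qed simp

lemma dvd_if_primepows_dvd:
  assumes "0 < (n::nat)" "\<And>q. primepow q \<Longrightarrow> q dvd n \<Longrightarrow> q dvd k"
  shows "n dvd k"
proof (cases "k = 0")
  case False
  show ?thesis
  proof (rule multiplicity_le_imp_dvd)
    fix p :: nat assume p: "prime p"
    show "multiplicity p n \<le> multiplicity p k"
    proof (cases "multiplicity p n = 0")
      case False
      then have "primepow (p ^ multiplicity p n)" using p by (simp add: primepow_prime_power)
      then have "p ^ multiplicity p n dvd k" using assms(2) multiplicity_dvd by blast
      then show ?thesis using p \<open>k \<noteq> 0\<close> by (intro multiplicity_geI) (auto simp: prime_gt_1_nat)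
    qed simp
  qed (use assms in simp)
qed simp

text \<open>For \<open>m = p ^ f\<close> with \<open>f \<ge> 2\<close> the length test \<open>q = 0\<close> can be dropped in favour of \<open>q = m\<close>,
  because the test for another prime then forces the number of entries equal to \<open>m\<close>.\<close>
definition test_set :: "nat \<Rightarrow> nat set" where
  "test_set m = (if primepow m \<and> \<not> prime m then {q. q \<le> m \<and> primepow q}
                 else insert 0 {q. q \<le> m - 1 \<and> primepow q})"

text \<open>In either case one number, \<open>m\<close> or 0, joins the prime powers up to
  \<open>m - 1\<close>. The positive example later accounts for the other unit in
  \<open>2 + Ppow (m - 1)\<close>.\<close>

lemma card_test_set: "card (test_set m) \<le> Suc (Ppow (m - 1))"
proof -
  have fin: "finite {q. q \<le> m - 1 \<and> primepow q}" by simp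
  have "test_set m \<subseteq> insert m {q. q \<le> m - 1 \<and> primepow q} \<or>
        test_set m \<subseteq> insert 0 {q. q \<le> m - 1 \<and> primepow q}"
    unfolding test_set_def by (cases m) (auto simp: le_Suc_eq)
  then obtain x where "test_set m \<subseteq> insert x {q. q \<le> m - 1 \<and> primepow q}" by blast
  then have "card (test_set m) \<le> card (insert x {q. q \<le> m - 1 \<and> primepow q})"
    using fin by (intro card_mono) auto
  also have "\<dots> \<le> Suc (Ppow (m - 1))" unfolding Ppow_def using fin by (simp add: card_insert_if)
  finally show ?thesis .
qed

lemma finite_test_set: "finite (test_set m)"
  unfolding test_set_def by simp

text \<open>Without the test 0, the test \<open>m\<close> compares the numbers of entries below
  \<open>m\<close>. These embed with equal length, so those of \<open>ms\<close> divide those of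
  \<open>ns\<close> one by one; the test \<open>p'\<close>, which does not divide \<open>m\<close>,
  then bounds the number of entries of \<open>ms\<close> equal to \<open>m\<close>.\<close>

lemma emb_test_set_length:
  assumes "emb ns ms" "\<forall>n\<in>set ns. 2 \<le> n \<and> n \<le> m" "\<forall>n\<in>set ms. 2 \<le> n \<and> n \<le> m"
    and count: "\<And>q. q \<in> test_set m \<Longrightarrow> ncount q ms \<le> ncount q ns"
  shows "length ms = length ns"
proof (rule antisym)
  have "0 \<notin> set ns" "0 \<notin> set ms" using assms(2,3) by auto
  then show "length ns \<le> length ms" using emb_length[OF assms(1)] by simp
  show "length ms \<le> length ns"
  proof (cases "primepow m \<and> \<not> prime m")
    case False
    then have "0 \<in> test_set m" by (simp add: test_set_def)
    then have "ncount 0 ms \<le> ncount 0 ns" by (rule count)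
    moreover have "ncount 0 xs = length xs" if "0 \<notin> set xs" for xs
      using that by (auto simp: filter_id_conv intro!: arg_cong[of _ _ length] gr0I)
    ultimately show ?thesis using \<open>0 \<notin> set ns\<close> \<open>0 \<notin> set ms\<close> by metis
  next
    case True
    then obtain p k where pk: "prime p" "m = p ^ k" by (auto simp: primepow_def)
    \<comment> \<open>A prime other than \<open>p\<close> that is at most 3 is among the tests,
      because \<open>m\<close> is at least 4.\<close>
    define p' :: nat where "p' = (if p = 2 then 3 else 2)"
    have p': "prime p'" "p' \<noteq> p" unfolding p'_def by auto
    have m4: "4 \<le> m" 
    proof -
      have "m \<noteq> 2" "m \<noteq> 3" "1 < m" using True two_is_prime_nat prime_nat_numeral_eq primepow_gt_Suc_0 by auto
      then show ?thesis by linarith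
    qed
    have "p' \<in> test_set m" using True p' m4 by (auto simp: test_set_def p'_def primepow_prime)
    have "\<not> p' dvd m" using pk p' by (metis prime_dvd_power primes_dvd_imp_eq)
    define f where "f = filter (\<lambda>n. n < m)"
    have split: "length xs = length (f xs) + length (filter (\<lambda>n. n = m) xs)" 
      "ncount p' xs = ncount p' (f xs) + length (filter (\<lambda>n. n = m) xs)"
      "ncount m xs = length (f xs)"
      if "\<forall>n\<in>set xs. 2 \<le> n \<and> n \<le> m" for xs
      using that \<open>\<not> p' dvd m\<close> unfolding f_def by (induction xs) (auto dest: dvd_imp_le intro: le_neq_implies_less)
    have e: "emb (f ns) (f ms)" unfolding f_def using assms m4 by (intro emb_filter_less) auto
    have "0 \<notin> set (f ns)" unfolding f_def using assms(2) by auto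
    have "m \<in> test_set m" using True by (simp add: test_set_def)
    then have "length (f ms) \<le> length (f ns)" using count[of m] split(3)[OF assms(2)] split(3)[OF assms(3)] by simp
    then have leq: "length (f ns) = length (f ms)" using emb_length[OF e \<open>0 \<notin> set (f ns)\<close>] by simp
    then have "list_all2 (dvd) (f ms) (f ns)" using emb_same_length[OF e \<open>0 \<notin> set (f ns)\<close>] by simp
    then have "ncount p' (f ns) \<le> ncount p' (f ms)" by (rule list_all2_dvd_ncount)
    then show ?thesis
      using count[OF \<open>p' \<in> test_set m\<close>] leq split(1,2)[OF assms(2)] split(1,2)[OF assms(3)] by linarith
  qed
qed

text \<open>Equal lengths give \<open>ms ! i dvd ns ! i\<close>, and the tests give the converse
  through the prime powers dividing \<open>ns ! i\<close>.\<close>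

lemma emb_test_set_eq:
  assumes "emb ns ms" "\<forall>n\<in>set ns. 2 \<le> n \<and> n \<le> m" "\<forall>n\<in>set ms. 2 \<le> n \<and> n \<le> m"
    and count: "\<And>q. q \<in> test_set m \<Longrightarrow> ncount q ms \<le> ncount q ns"
  shows "ms = ns"
proof -
  have len: "length ms = length ns" using assms by (rule emb_test_set_length)
  have "0 \<notin> set ns" using assms(2) by auto
  then have dv: "list_all2 (dvd) ms ns" using emb_same_length assms(1) len by simp
  have "ns ! i dvd ms ! i" if i: "i < length ns" for i
  proof -
    have b: "2 \<le> ns ! i" "ns ! i \<le> m" "2 \<le> ms ! i" using assms i len by auto
    have md: "ms ! i dvd ns ! i" using dv i by (auto simp: list_all2_conv_all_nth)
    \<comment> \<open>A prime \<open>m\<close> is not a test itself, but a divisor of it that is at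
      least 2 must equal \<open>m\<close>.\<close>
    show ?thesis
    proof (cases "ns ! i = m \<and> prime m")
      case True
      then have "ms ! i = m" using md b by (metis prime_nat_iff Suc_1 not_less_eq_eq order_refl One_nat_def)
      then show ?thesis using True by simp
    next
      case False
      show ?thesis
      proof (rule dvd_if_primepows_dvd)
        fix q assume q: "primepow q" "q dvd ns ! i"
        have "q \<le> ns ! i" using q b by (auto intro: dvd_imp_le)
        moreover have "q = m \<longrightarrow> primepow m \<and> \<not> prime m" using q False calculation b by auto
        ultimately have "q \<in> test_set m" using q b unfolding test_set_def by auto
        from list_all2_dvd_ncount_eq[OF dv count[OF this]]
        show "q dvd ms ! i" using q(2) i len by (auto simp: list_all2_conv_all_nth)
      qed (use b in simp)
    qed
  qed
  then show ?thesis
    using dv len by (intro nth_equalityI) (auto simp: list_all2_conv_all_nth intro: dvd_antisym)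
qed

lemma TD_NC_m_le:
  assumes z: "2 \<le> z" and m: "2 \<le> m"
  shows "TD (Sig z) (NC_m z m) \<le> enat (2 + Ppow (m - 1))"
  unfolding TD_def
proof (intro SUP_least)
  let ?S = "Sig z"
  note S01 = Sig_ge_two[OF z]
  have cases2: "L = lists ?S \<or> (\<exists>ns. L = pow_lang ?S ns \<and> (\<forall>n\<in>set ns. 2 \<le> n \<and> n \<le> m))"
    if L: "L \<in> NC_m z m" for L
  proof -
    obtain ns where ns: "L = pow_lang ?S ns" "\<forall>n\<in>set ns. 0 < n \<and> n \<le> m"
      using L unfolding NC_m_eq by blast
    show ?thesis
    proof (cases "1 \<in> set ns")
      case True
      then show ?thesis using ns pow_lang_one by blast
    next
      case False
      then have "\<forall>n\<in>set ns. 2 \<le> n \<and> n \<le> m"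
        using ns(2) by (metis One_nat_def Suc_1 Suc_leI le_neq_implies_less)
      then show ?thesis using ns by blast
    qed
  qed
  fix L assume "L \<in> NC_m z m"
  then consider "L = lists ?S" | ns where "L = pow_lang ?S ns" "\<forall>n\<in>set ns. 2 \<le> n \<and> n \<le> m"
    using cases2 by blast
  then show "TD_of ?S (NC_m z m) L \<le> enat (2 + Ppow (m - 1))"
  proof cases
    case 1
    have "L' = L" if "L' \<in> NC_m z m" "[0] \<in> L'" for L'
      using cases2[OF that(1)] that(2) 1 singleton_in_pow_langD[of 0 ?S] by fastforce
    then have "teaching_set ?S (NC_m z m) L {([0], True)}"
      using 1 S01 by (auto simp: teaching_set_def consistent_def)
    then show ?thesis by (rule TD_of_le) auto
  next
    case (2 ns)
    define T where "T = insert (char_word ns, True) ((\<lambda>q. (test_word m q ns, False)) ` test_set m)"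
    have qs: "q = 0 \<or> primepow q" if "q \<in> test_set m" for q
      using that by (auto simp: test_set_def split: if_splits)
    have "card T \<le> Suc (card ((\<lambda>q. (test_word m q ns, False)) ` test_set m))"
      unfolding T_def using finite_test_set[of m] by (simp add: card_insert_if)
    also have "\<dots> \<le> Suc (card (test_set m))" by (simp add: card_image_le finite_test_set)
    finally have "card T \<le> Suc (card (test_set m))" .
    then have cardT: "card T \<le> 2 + Ppow (m - 1)" using card_test_set[of m] by simp
    have "teaching_set ?S (NC_m z m) L T"
      unfolding teaching_set_def
    proof (intro conjI ballI impI)
      show "fst ` T \<subseteq> lists ?S" unfolding T_def test_word_def image_insert image_image fst_conv
        using char_word_lists[OF S01] by blast
      show "consistent L T"
        unfolding consistent_def T_def using 2 char_word_in_pow_lang[OF S01, of ns]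
          test_word_in_pow_lang_iff[OF S01 qs 2(2)] by auto
    next
      fix L' assume L': "L' \<in> NC_m z m" "consistent L' T"
      \<comment> \<open>Some negative example is present, which excludes the language of all
        words.\<close>
      have "test_set m \<noteq> {}" unfolding test_set_def by auto
      then have "L' \<noteq> lists ?S"
        using L'(2) char_word_lists[OF S01] unfolding consistent_def T_def test_word_def by fastforce
      then obtain ms where ms: "L' = pow_lang ?S ms" "\<forall>n\<in>set ms. 2 \<le> n \<and> n \<le> m"
        using cases2[OF L'(1)] by blast
      have "char_word ns \<in> pow_lang ?S ms" using L'(2) ms unfolding consistent_def T_def by simp
      then have "emb ns ms" using char_word_in_pow_langD ms by blast
      moreover have "ncount q ms \<le> ncount q ns" if "q \<in> test_set m" for q
      proof -
        have "test_word m q ns \<notin> pow_lang ?S ms" using L'(2) ms that unfolding consistent_def T_def by simp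
        then show ?thesis using test_word_in_pow_lang_iff[OF S01 qs[OF that] ms(2)] by simp
      qed
      ultimately have "ms = ns" using emb_test_set_eq[of ns ms m] 2(2) ms(2) by blast
      then show "L' = L" using ms 2 by simp
    qed
    moreover have "finite T" unfolding T_def using finite_test_set by simp
    ultimately show ?thesis using cardT by (intro TD_of_le)
  qed
qed

section \<open>Unary alphabets\<close>

text \<open>Over one letter a word is its length, and a language becomes the submonoid of the
  natural numbers generated by the exponents.\<close>

fun gen_monoid :: "nat list \<Rightarrow> nat set" where
  "gen_monoid [] = {0}"
| "gen_monoid (n # ns) = {n * k + s | k s. s \<in> gen_monoid ns}"

lemma zero_in_gen_monoid: "0 \<in> gen_monoid ns"
  by (induction ns) auto

lemma gen_monoid_Cons_subset: "gen_monoid ns \<subseteq> gen_monoid (n # ns)"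
proof
  fix s assume "s \<in> gen_monoid ns"
  moreover have "s = n * 0 + s" by simp
  ultimately show "s \<in> gen_monoid (n # ns)" unfolding gen_monoid.simps by blast
qed

lemma set_subset_gen_monoid: "set ns \<subseteq> gen_monoid ns"
proof (induction ns)
  case (Cons n ns)
  have "n = n * 1 + 0" by simp
  then have "n \<in> gen_monoid (n # ns)"
    unfolding gen_monoid.simps using zero_in_gen_monoid by blast
  moreover have "set ns \<subseteq> gen_monoid (n # ns)"
    using Cons gen_monoid_Cons_subset by blast
  ultimately show ?case by simp
qed simp

lemma gen_monoid_add: "x \<in> gen_monoid ns \<Longrightarrow> y \<in> gen_monoid ns \<Longrightarrow> x + y \<in> gen_monoid ns"
proof (induction ns arbitrary: x y)
  case (Cons n ns)
  then obtain k s k' s' where "x = n * k + s" "y = n * k' + s'" "s \<in> gen_monoid ns" "s' \<in> gen_monoid ns"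
    by auto
  moreover from this have "x + y = n * (k + k') + (s + s')" by (simp add: algebra_simps)
  ultimately show ?case using Cons.IH unfolding gen_monoid.simps by blast
qed simp

lemma gen_monoid_least:
  assumes "0 \<in> M" "\<And>x y. x \<in> M \<Longrightarrow> y \<in> M \<Longrightarrow> x + y \<in> M" "set ns \<subseteq> M"
  shows "gen_monoid ns \<subseteq> M"
  using assms(3)
proof (induction ns)
  case (Cons n ns)
  have "n * k \<in> M" for k by (induction k) (use Cons assms in auto)
  then show ?case using Cons assms by auto
qed (use assms in simp)

lemma Sig_one: "Sig 1 = {0}"
  by (auto simp: Sig_def one_enat_def)

lemma lists_singleton: "lists {a} = range (\<lambda>k. replicate k a)"
proof (intro subset_antisym subsetI)
  fix w assume "w \<in> lists {a}"
  then have "w = replicate (length w) a" by (intro replicate_eqI) auto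
  then show "w \<in> range (\<lambda>k. replicate k a)" by blast
qed auto

lemma concat_replicate_replicate: "concat (replicate n (replicate k a)) = replicate (n * k) a"
  by (induction n) (simp_all add: replicate_add)

lemma pow_lang_unary: "pow_lang {0} ns = (\<lambda>k. replicate k 0) ` gen_monoid ns"
proof (induction ns)
  case (Cons n ns)
  have "pow_lang {0} (n # ns) = {concat (replicate n (replicate k 0)) @ replicate s 0 | k s. s \<in> gen_monoid ns}"
    unfolding pow_lang.simps Cons lists_singleton by blast
  also have "\<dots> = (\<lambda>k. replicate k 0) ` gen_monoid (n # ns)"
    by (auto simp: concat_replicate_replicate replicate_add[symmetric])
  finally show ?case .
qed simp

lemma replicate_in_pow_lang_unary: "replicate k 0 \<in> pow_lang {0} ns \<longleftrightarrow> k \<in> gen_monoid ns"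
  unfolding pow_lang_unary by (auto dest: arg_cong[of _ _ length])

text \<open>Labelling all lengths from 1 to \<open>m\<close> suffices, because all generators lie in
  this range.\<close>

lemma TD_unary_le: "TD (Sig 1) (NC_m 1 m) \<le> enat m"
  unfolding TD_def
proof (intro SUP_least)
  fix L assume "L \<in> NC_m 1 m"
  then obtain ns where ns: "L = pow_lang {0} ns" "\<forall>n\<in>set ns. 0 < n \<and> n \<le> m"
    unfolding NC_m_eq Sig_one by blast
  let ?T = "(\<lambda>k. (replicate k 0, replicate k 0 \<in> L)) ` {1..m}"
  have "teaching_set (Sig 1) (NC_m 1 m) L ?T"
    unfolding teaching_set_def
  proof (intro conjI ballI impI)
    show "fst ` ?T \<subseteq> lists (Sig 1)" by (auto simp: Sig_one)
    show "consistent L ?T" by (auto simp: consistent_def)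
    fix L' assume L': "L' \<in> NC_m 1 m" "consistent L' ?T"
    then obtain ms where ms: "L' = pow_lang {0} ms" "\<forall>n\<in>set ms. 0 < n \<and> n \<le> m"
      unfolding NC_m_eq Sig_one by blast
    have iff: "k \<in> gen_monoid ms \<longleftrightarrow> k \<in> gen_monoid ns" if "k \<in> {1..m}" for k
      using L'(2) that unfolding consistent_def ms ns by (auto simp: replicate_in_pow_lang_unary)
    have "set ms \<subseteq> gen_monoid ns"
    proof
      fix n assume n: "n \<in> set ms"
      then have "n \<in> {1..m}" using ms(2) by (simp add: Suc_le_eq)
      then show "n \<in> gen_monoid ns" using iff n set_subset_gen_monoid by blast
    qed
    moreover have "set ns \<subseteq> gen_monoid ms"
    proof
      fix n assume n: "n \<in> set ns"
      then have "n \<in> {1..m}" using ns(2) by (simp add: Suc_le_eq)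
      then show "n \<in> gen_monoid ms" using iff n set_subset_gen_monoid by blast
    qed
    ultimately have "gen_monoid ms = gen_monoid ns"
      by (intro subset_antisym gen_monoid_least zero_in_gen_monoid gen_monoid_add)
    then show "L' = L" unfolding ms ns pow_lang_unary by simp
  qed
  moreover have "card ?T \<le> m" using card_image_le[of "{1..m}"] by fastforce
  ultimately show "TD_of (Sig 1) (NC_m 1 m) L \<le> enat m" by (intro TD_of_le) auto
qed

definition cube_gens :: "nat \<Rightarrow> nat set \<Rightarrow> nat list" where
  "cube_gens q A = [2 * q..<3 * q + 1] @ sorted_list_of_set A"

text \<open>A sum of two nonzero elements is at least 4q, so nothing new arises below 4q and
  \<open>A\<close> is free. Conversely, sums of numbers from 2q to 3q reach everything from 4q
  on.\<close>

lemma gen_monoid_cube: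
  assumes "A \<subseteq> {3 * q<..<4 * q}" "0 < q"
  shows "gen_monoid (cube_gens q A) = {0} \<union> {2 * q..3 * q} \<union> A \<union> {4 * q..}"
proof
  have fin: "finite A" using assms(1) finite_subset by blast
  have set: "set (cube_gens q A) = {2 * q..3 * q} \<union> A"
    unfolding cube_gens_def using fin by auto
  show "gen_monoid (cube_gens q A) \<subseteq> {0} \<union> {2 * q..3 * q} \<union> A \<union> {4 * q..}"
  proof (rule gen_monoid_least)
    let ?M = "{0} \<union> {2 * q..3 * q} \<union> A \<union> {4 * q..}"
    have ge: "x = 0 \<or> 2 * q \<le> x" if "x \<in> ?M" for x using that assms(1) by (auto simp: subset_iff)
    fix x y assume xy: "x \<in> ?M" "y \<in> ?M"
    show "x + y \<in> ?M"
    proof (cases "x = 0 \<or> y = 0")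
      case False
      then show ?thesis using ge[OF xy(1)] ge[OF xy(2)] by simp
    qed (use xy in auto)
  qed (use set in auto)
  have low: "k \<in> gen_monoid (cube_gens q A)" if "2 * q \<le> k" "k \<le> 3 * q" for k
    using that set_subset_gen_monoid[of "cube_gens q A"] set by auto
  have "k \<in> gen_monoid (cube_gens q A)" if "4 * q \<le> k" for k
    using that
  proof (induction k rule: less_induct)
    case (less k)
    show ?case
    proof (cases "k \<le> 6 * q")
      case True
      \<comment> \<open>From 4q to 6q, both halves lie between 2q and 3q; larger numbers are reduced
        by 2q.\<close>
      have "k = k div 2 + (k - k div 2)" by simp
      moreover have "k div 2 \<in> gen_monoid (cube_gens q A)" "k - k div 2 \<in> gen_monoid (cube_gens q A)"
        using True less.prems by (intro low; linarith)+
      ultimately show ?thesis using gen_monoid_add by metis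
    next
      case False
      have "k - 2 * q \<in> gen_monoid (cube_gens q A)" using False assms(2) by (intro less.IH) auto
      moreover have "2 * q \<in> gen_monoid (cube_gens q A)" by (rule low) auto
      moreover have "k = (k - 2 * q) + 2 * q" using False by simp
      ultimately show ?thesis using gen_monoid_add by metis
    qed
  qed
  moreover have "A \<subseteq> gen_monoid (cube_gens q A)" using set set_subset_gen_monoid by blast
  ultimately show "{0} \<union> {2 * q..3 * q} \<union> A \<union> {4 * q..} \<subseteq> gen_monoid (cube_gens q A)"
    using low zero_in_gen_monoid by auto
qed

lemma strict_po_on_finite_minimal:
  assumes "strict_po_on C R" "finite F" "F \<noteq> {}"
  shows "\<exists>x\<in>F. \<forall>y\<in>F. (y, x) \<notin> R"
proof -
  let ?R = "R \<inter> F \<times> F"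
  have "irrefl ?R" "trans ?R" using assms(1) unfolding strict_po_on_def irrefl_def trans_def by blast+
  then have "acyclic ?R" by (simp add: acyclic_irrefl)
  moreover have "finite ?R" using assms(2) by simp
  ultimately have "wf ?R" by (rule finite_acyclic_wf[rotated])
  then obtain x where "x \<in> F" "\<And>y. (y, x) \<in> ?R \<Longrightarrow> y \<notin> F"
    using assms(3) by (metis wfE_min ex_in_conv)
  then show ?thesis by blast
qed

text \<open>The languages of \<open>cube_gens q A\<close> form a Boolean cube; a most preferred vertex of it must be
  separated from all its neighbours, each of which differs from it in a single word.\<close>
lemma PBTD_unary_ge:
  assumes "0 < q" "4 * q \<le> m"
  shows "enat (q - 1) \<le> PBTD (Sig 1) (NC_m 1 m)"
  unfolding PBTD_def
proof (intro INF_greatest)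
  let ?D = "{3 * q<..<4 * q}"
  let ?L = "\<lambda>A. pow_lang {0} (cube_gens q A)"
  fix R assume "R \<in> {R. strict_po_on (NC_m 1 m) R}"
  then have "strict_po_on (NC_m 1 m) R" by simp
  moreover have "finite (?L ` Pow ?D)" "?L ` Pow ?D \<noteq> {}" by auto
  ultimately obtain L where L: "L \<in> ?L ` Pow ?D" "\<forall>L'\<in>?L ` Pow ?D. (L', L) \<notin> R"
    using strict_po_on_finite_minimal by metis
  then obtain A where A: "A \<subseteq> ?D" "L = ?L A" by blast
  have mem: "?L B \<in> NC_m 1 m" if "B \<subseteq> ?D" for B
  proof -
    have "finite B" using that finite_subset by blast
    then have "\<forall>n\<in>set (cube_gens q B). 0 < n \<and> n \<le> m" "cube_gens q B \<noteq> []"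
      using that assms unfolding cube_gens_def by (auto simp: subset_iff)
    then show ?thesis unfolding NC_m_eq Sig_one by blast
  qed
  have "q - 1 \<le> card T" if T: "teaching_set (Sig 1) (NC_m 1 m - {L'. (L', L) \<in> R}) L T" "finite T" for T
  proof -
    have "replicate i 0 \<in> fst ` T" if i: "i \<in> ?D" for i
    proof -
      \<comment> \<open>Flipping the membership of \<open>i\<close> changes the language only in the
        word of length \<open>i\<close>, so that word must occur in \<open>T\<close>.\<close>
      define B where "B = (if i \<in> A then A - {i} else insert i A)"
      have B: "B \<subseteq> ?D" using A i by (auto simp: B_def)
      have diff: "k \<in> gen_monoid (cube_gens q B) \<longleftrightarrow> k \<in> gen_monoid (cube_gens q A)" if "k \<noteq> i" for k
        unfolding gen_monoid_cube[OF B assms(1)] gen_monoid_cube[OF A(1) assms(1)]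
        unfolding B_def using that by auto
      have "(i \<in> gen_monoid (cube_gens q B)) \<noteq> (i \<in> gen_monoid (cube_gens q A))"
        unfolding gen_monoid_cube[OF B assms(1)] gen_monoid_cube[OF A(1) assms(1)]
        unfolding B_def using i by auto
      then have "?L B \<noteq> L" unfolding A(2) using replicate_in_pow_lang_unary by blast
      moreover have "?L B \<in> NC_m 1 m - {L'. (L', L) \<in> R}" using mem[OF B] L(2) B by blast
      ultimately have "\<not> consistent (?L B) T" using T(1) unfolding teaching_set_def by blast
      then obtain w b where wb: "(w, b) \<in> T" "(w \<in> ?L B) \<noteq> b" unfolding consistent_def by auto
      have "(w \<in> L) = b" using T(1) wb(1) unfolding teaching_set_def consistent_def by blast
      have "w \<in> lists {0}" using T(1) wb(1) unfolding teaching_set_def Sig_one by force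
      then obtain k where k: "w = replicate k 0" unfolding lists_singleton by blast
      have "k = i"
        using diff[of k] wb(2) \<open>(w \<in> L) = b\<close> unfolding A(2) k replicate_in_pow_lang_unary by blast
      then show ?thesis using wb(1) k by force
    qed
    then have "(\<lambda>i. replicate i 0) ` ?D \<subseteq> fst ` T" by blast
    then have "card ((\<lambda>i. replicate i (0::nat)) ` ?D) \<le> card (fst ` T)" using T(2) by (intro card_mono) auto
    also have "\<dots> \<le> card T" using T(2) by (rule card_image_le)
    finally have "card ((\<lambda>i. replicate i (0::nat)) ` ?D) \<le> card T" .
    moreover have "inj_on (\<lambda>i. replicate i (0::nat)) ?D" by (rule inj_onI) (metis length_replicate)
    ultimately show ?thesis using assms(1) by (simp add: card_image)
  qed
  then have "enat (q - 1) \<le> TD_of (Sig 1) (NC_m 1 m - {L'. (L', L) \<in> R}) L" by (rule TD_of_ge)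
  also have "\<dots> \<le> PBTD_wrt (Sig 1) (NC_m 1 m) R"
    unfolding PBTD_wrt_def using mem[OF A(1)] A(2) by (intro SUP_upper) auto
  finally show "enat (q - 1) \<le> PBTD_wrt (Sig 1) (NC_m 1 m) R" .
qed

text \<open>The function \<open>f\<close> stands for either dimension: the cube bounds the smaller
  one from below, the full labelling bounds the larger one from above.\<close>

lemma Theta_linear_unary:
  fixes f :: "nat \<Rightarrow> enat"
  assumes "\<And>m. PBTD (Sig 1) (NC_m 1 m) \<le> f m" "\<And>m. f m \<le> TD (Sig 1) (NC_m 1 m)"
  shows "\<exists>c1 c2 :: real. c1 > 0 \<and> c2 > 0 \<and> (\<forall>\<^sub>F m in sequentially.
    \<exists>t. f m = enat t \<and> c1 * real m \<le> real t \<and> real t \<le> c2 * real m)"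
proof -
  \<comment> \<open>With \<open>q = m div 4\<close>, the lower bound \<open>q - 1\<close> is at
    least \<open>m / 8\<close> from 16 on.\<close>
  have "\<exists>t. f m = enat t \<and> 1 / 8 * real m \<le> real t \<and> real t \<le> 1 * real m" if m: "16 \<le> m" for m
  proof -
    have up: "f m \<le> enat m" using assms(2) TD_unary_le order_trans by blast
    then obtain t where t: "f m = enat t" by (cases "f m") auto
    have "enat (m div 4 - 1) \<le> f m"
      using PBTD_unary_ge[of "m div 4" m] m by (intro order_trans[OF _ assms(1)]) auto
    then have "m div 4 - 1 \<le> t" "t \<le> m" using t up by auto
    moreover have "m \<le> 8 * (m div 4 - 1)" using m by linarith
    ultimately have "real m \<le> 8 * real t" "real t \<le> real m" by linarith+
    then show ?thesis using t by auto
  qed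
  then have "\<forall>\<^sub>F m in sequentially.
      \<exists>t. f m = enat t \<and> 1 / 8 * real m \<le> real t \<and> real t \<le> 1 * real m"
    by (rule eventually_sequentiallyI)
  moreover have "(0::real) < 1 / 8" "(0::real) < 1" by simp_all
  ultimately show ?thesis by blast
qed

section \<open>An elementary upper bound for the number of primes\<close>

lemma dvd_prod_interval:
  fixes p :: nat
  assumes "a < p * k" "p * k \<le> b"
  shows "p dvd \<Prod>{Suc a..b}"
proof -
  have "p * k dvd \<Prod>{Suc a..b}" using assms by (intro dvd_prod_eqI[where a = "p * k"]) auto
  then show ?thesis by (rule dvd_mult_left)
qed

lemma prime_not_dvd_prod_interval:
  fixes p :: nat
  assumes "prime p" "b < 2 * p"
  shows "\<not> p dvd \<Prod>{Suc p..b}"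
proof
  assume "p dvd \<Prod>{Suc p..b}"
  then obtain x where x: "x \<in> {Suc p..b}" "p dvd x" using prime_dvd_prod_iff[OF _ assms(1), of "{Suc p..b}" "\<lambda>x. x"] by auto
  then obtain j where j: "x = p * j" by auto
  then have "p * j < p * 2" using x(1) assms(2) unfolding atLeastAtMost_iff by linarith
  then have "j < 2" by simp
  then have "j = 0 \<or> j = 1" by linarith
  then show False using x j by auto
qed

text \<open>The product is (6n)! / ((3n)! (2n)! n!). In each of four ranges of \<open>p\<close>, the
  numerator contains \<open>p\<close> more often than the denominator.\<close>

lemma prime_dvd_choose_product:
  assumes p: "prime p" and "n < p" "p \<le> 6 * n"
  shows "p dvd (6 * n choose (3 * n)) * (3 * n choose n)"
proof -
  have pf: "p dvd fact k \<longleftrightarrow> p \<le> k" for k by (simp add: prime_dvd_fact_iff[OF p])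
  have f6: "fact (3 * n) * fact (3 * n) * (6 * n choose (3 * n)) = (fact (6 * n) :: nat)"
    using binomial_fact_lemma[of "3 * n" "6 * n"] by simp
  have f3: "fact n * fact (2 * n) * (3 * n choose n) = (fact (3 * n) :: nat)"
    using binomial_fact_lemma[of n "3 * n"] by simp
  consider "3 * n < p" | "2 * n < p" "p \<le> 3 * n" | "2 * p \<le> 3 * n" | "3 * n < 2 * p" "p \<le> 2 * n"
    by linarith
  then show ?thesis
  proof cases
    case 1
    have "p dvd fact (3 * n) * fact (3 * n) * (6 * n choose (3 * n))" unfolding f6 pf by fact
    then have "p dvd (6 * n choose (3 * n))" using 1 by (simp add: prime_dvd_mult_iff[OF p] pf)
    then show ?thesis by simp
  next
    case 2
    have "p dvd fact n * fact (2 * n) * (3 * n choose n)" unfolding f3 pf by fact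
    then have "p dvd (3 * n choose n)" using 2 assms(2) by (simp add: prime_dvd_mult_iff[OF p] pf)
    then show ?thesis by simp
  next
    case 3
    have "fact (2 * n) * (fact n * (3 * n choose n)) = fact (2 * n) * \<Prod>{Suc (2 * n)..3 * n}"
      using f3 fact_eq_fact_times[of "2 * n" "3 * n"] by (simp add: ac_simps)
    then have "fact n * (3 * n choose n) = \<Prod>{Suc (2 * n)..3 * n}"
      by simp
    \<comment> \<open>The multiple 2p lies above 2n and not above 3n.\<close>
    moreover have "p dvd \<Prod>{Suc (2 * n)..3 * n}"
      using 3 assms(2) by (intro dvd_prod_interval[of _ _ 2]) auto
    ultimately have "p dvd fact n * (3 * n choose n)" by simp
    then have "p dvd (3 * n choose n)" using assms(2) by (simp add: prime_dvd_mult_iff[OF p] pf)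
    then show ?thesis by simp
  next
    case 4
    let ?X = "\<Prod>{Suc (3 * n)..4 * n}" and ?Y = "\<Prod>{Suc (4 * n)..6 * n}" and ?Z = "\<Prod>{Suc p..3 * n}"
    have "fact (6 * n) = fact (3 * n) * ?X * ?Y"
      using fact_eq_fact_times[of "4 * n" "6 * n"] fact_eq_fact_times[of "3 * n" "4 * n"] by simp
    then have "fact (3 * n) * (fact (3 * n) * (6 * n choose (3 * n))) = fact (3 * n) * (?X * ?Y)"
      using f6 by (simp add: ac_simps)
    then have "fact (3 * n) * (6 * n choose (3 * n)) = ?X * ?Y" by simp
    \<comment> \<open>Here 2p lies in (3n, 4n] and 3p in (4n, 6n], whereas (3n)! contains
      \<open>p\<close> only once.\<close>
    moreover have "p dvd ?X" using 4 by (intro dvd_prod_interval[of _ _ 2]) auto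
    moreover have "p dvd ?Y" using 4 assms by (intro dvd_prod_interval[of _ _ 3]) auto
    ultimately have "p * p dvd fact (3 * n) * (6 * n choose (3 * n))" by (simp add: mult_dvd_mono)
    moreover have "fact (3 * n) = p * (fact (p - 1) * ?Z)"
      using fact_eq_fact_times[of p "3 * n"] fact_reduce[of p, where 'a = nat] prime_gt_0_nat[OF p] 4
      by simp
    ultimately have "p dvd fact (p - 1) * ?Z * (6 * n choose (3 * n))"
      using prime_gt_0_nat[OF p] by (simp add: mult.assoc)
    then have "p dvd (6 * n choose (3 * n))"
      using prime_not_dvd_prod_interval[OF p, of "3 * n"] 4 prime_gt_0_nat[OF p]
      unfolding prime_dvd_mult_iff[OF p] pf by auto
    then show ?thesis by simp
  qed
qed

lemma prod_primes_dvd: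
  fixes N :: nat
  assumes "finite A" "\<And>p. p \<in> A \<Longrightarrow> prime p" "\<And>p. p \<in> A \<Longrightarrow> p dvd N"
  shows "\<Prod>A dvd N"
  using assms
proof (induction A rule: finite_induct)
  case (insert p A)
  have "coprime p (\<Prod>A)"
    using insert by (intro prod_coprime_right primes_coprime) auto
  then show ?case using insert by (auto intro: divides_mult)
qed simp

text \<open>Chebyshev's theta function.\<close>

definition theta :: "nat \<Rightarrow> real" where
  "theta n = (\<Sum>p | prime p \<and> p \<le> n. ln (real p))"

lemma theta_eq_add:
  assumes "a \<le> b"
  shows "theta b = theta a + (\<Sum>p | prime p \<and> a < p \<and> p \<le> b. ln (real p))"
proof -
  have "{p. prime p \<and> p \<le> b} = {p. prime p \<and> p \<le> a} \<union> {p. prime p \<and> a < p \<and> p \<le> b}"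
    using assms by auto
  then show ?thesis unfolding theta_def by (subst sum.union_disjoint[symmetric]) auto
qed

lemma ln_prime_nonneg: "prime p \<Longrightarrow> 0 \<le> ln (real p)"
  using prime_gt_0_nat[of p] by simp

lemma theta_mono: "a \<le> b \<Longrightarrow> theta a \<le> theta b"
  by (subst theta_eq_add[of a b]) (auto intro!: sum_nonneg ln_prime_nonneg)

text \<open>The primes in \<open>(n, 6n]\<close> divide \<open>(6n)! / ((3n)! (2n)! n!)\<close>, which is at most \<open>2 ^ (9n)\<close>; iterating
  gives the constant \<open>9 ln 2 / 5 < 1.25506\<close>.\<close>
lemma theta_six_mult: "theta (6 * n) \<le> theta n + 9 * ln 2 * real n"
proof -
  let ?A = "{p. prime p \<and> n < p \<and> p \<le> 6 * n}"
  let ?N = "(6 * n choose (3 * n)) * (3 * n choose n)"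
  have fin: "finite ?A" by simp
  have "\<Prod>?A dvd ?N" by (rule prod_primes_dvd) (use prime_dvd_choose_product in auto)
  moreover have "?N > 0" by simp
  ultimately have "\<Prod>?A \<le> ?N" by (rule dvd_imp_le)
  also have "\<dots> \<le> 2 ^ (6 * n) * 2 ^ (3 * n)" by (intro mult_le_mono binomial_le_pow2)
  also have "\<dots> = (2::nat) ^ (9 * n)" by (simp flip: power_add)
  finally have "real (\<Prod>?A) \<le> 2 ^ (9 * n)" by (metis of_nat_le_iff of_nat_numeral of_nat_power)
  moreover have "0 < real (\<Prod>?A)" using prime_gt_0_nat by (auto intro!: prod_pos)
  ultimately have "ln (real (\<Prod>?A)) \<le> ln (2 ^ (9 * n))" by (subst ln_le_cancel_iff) auto
  also have "ln (real (\<Prod>?A)) = (\<Sum>p\<in>?A. ln (real p))"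
    by (subst of_nat_prod, rule ln_prod) (auto intro: prime_gt_0_nat)
  finally have "(\<Sum>p\<in>?A. ln (real p)) \<le> 9 * ln 2 * real n" by (simp add: ln_realpow mult_ac)
  then show ?thesis using theta_eq_add[of n "6 * n"] by simp
qed

text \<open>Rounding \<open>n\<close> down to a multiple of 6 loses at most six primes, each
  contributing at most \<open>ln n\<close>.\<close>

lemma theta_div_six:
  assumes "0 < n"
  shows "theta n \<le> theta (n div 6) + 6.25 * (real n / 6) + 6 * ln (real n)"
proof -
  let ?A = "{p. prime p \<and> 6 * (n div 6) < p \<and> p \<le> n}"
  have "(\<Sum>p\<in>?A. ln (real p)) \<le> real (card ?A) * ln (real n)"
    using prime_gt_0_nat by (intro sum_bounded_above) auto
  also have "\<dots> \<le> 6 * ln (real n)"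
  proof (rule mult_right_mono)
    have "card ?A \<le> card {6 * (n div 6)<..n}" by (intro card_mono) auto
    also have "\<dots> \<le> 6" by simp
    finally show "real (card ?A) \<le> 6" by simp
  qed (use assms in simp)
  finally have "theta n \<le> theta (6 * (n div 6)) + 6 * ln (real n)"
    using theta_eq_add[of "6 * (n div 6)" n] by simp
  \<comment> \<open>From \<open>ln 2 \<le> 25/36\<close>, as 9 * 25/36 = 6.25.\<close>
  moreover have "9 * ln 2 * real (n div 6) \<le> 6.25 * (real n / 6)"
    using ln2_le_25_over_36 by (intro mult_mono) auto
  ultimately show ?thesis using theta_six_mult[of "n div 6"] by linarith
qed

text \<open>Iteration sums a geometric series of ratio 1/6, which turns 6.25/6 into 6.25/5 = 1.25.
  The excess of 1.252 over this absorbs the logarithmic terms.\<close>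

lemma theta_bound: "\<exists>D. \<forall>n. theta n \<le> 1.252 * real n + D"
proof -
  have "eventually (\<lambda>n::nat. 6.25 * (real n / 6) + 6 * ln (real n) + 1.252 * (real n / 6) \<le> 1.252 * real n) sequentially"
    by real_asymp
  then obtain N where N: "\<And>n. n \<ge> N \<Longrightarrow> 6.25 * (real n / 6) + 6 * ln (real n) + 1.252 * (real n / 6) \<le> 1.252 * real n"
    by (auto simp: eventually_sequentially)
  have "theta n \<le> 1.252 * real n + theta N" for n
  proof (induction n rule: less_induct)
    case (less n)
    show ?case
    proof (cases "n \<le> N")
      case True
      then show ?thesis using theta_mono[OF True] by simp
    next
      case False
      have "theta n \<le> theta (n div 6) + 6.25 * (real n / 6) + 6 * ln (real n)"
        using False by (intro theta_div_six) auto
      also have "theta (n div 6) \<le> 1.252 * real (n div 6) + theta N"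
        using False by (intro less.IH) auto
      also have "1.252 * real (n div 6) \<le> 1.252 * (real n / 6)" by auto
      finally show ?thesis using N[of n] False by simp
    qed
  qed
  then show ?thesis by blast
qed

text \<open>Primes up to n^0.998 are counted trivially; each larger one contributes at least 0.998
  ln n to \<open>theta n\<close>. The exponent is so close to 1 that 1.252 / 0.998 <
  1.25506.\<close>

lemma card_primes_le:
  assumes "2 \<le> n"
  shows "real (card {p. prime p \<and> p \<le> n}) \<le> real n powr (998/1000) + theta n / (998/1000 * ln (real n))"
proof -
  define y where "y = real n powr (998/1000)"
  have y: "0 \<le> y" "0 < y" "ln y = 998/1000 * ln (real n)" unfolding y_def using assms by (auto simp: ln_powr)
  have ln: "0 < ln (real n)" using assms by simp
  let ?A = "{p. prime p \<and> p \<le> n \<and> real p \<le> y}" and ?B = "{p. prime p \<and> p \<le> n \<and> y < real p}"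
  have "card {p. prime p \<and> p \<le> n} = card (?A \<union> ?B)" by (rule arg_cong[of _ _ card]) auto
  also have "\<dots> = card ?A + card ?B" by (intro card_Un_disjoint) auto
  finally have eq: "card {p. prime p \<and> p \<le> n} = card ?A + card ?B" .
  have "?A \<subseteq> {1..nat \<lfloor>y\<rfloor>}" using prime_ge_1_nat by (auto simp: le_nat_floor)
  then have "card ?A \<le> nat \<lfloor>y\<rfloor>" using card_mono[of "{1..nat \<lfloor>y\<rfloor>}" ?A] by simp
  then have A: "real (card ?A) \<le> y" using y(1) by linarith
  have "real (card ?B) * (998/1000 * ln (real n)) \<le> (\<Sum>p\<in>?B. ln (real p))"
  proof (rule sum_bounded_below)
    fix p assume "p \<in> ?B"
    then have "ln y \<le> ln (real p)" using y(2) by simp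
    then show "998/1000 * ln (real n) \<le> ln (real p)" using y(3) by simp
  qed
  also have "\<dots> \<le> theta n" unfolding theta_def by (intro sum_mono2) (auto intro: ln_prime_nonneg)
  finally have "real (card ?B) \<le> theta n / (998/1000 * ln (real n))" using ln by (simp add: field_simps)
  then show ?thesis using A eq y_def by simp
qed

text \<open>A prime power that is not a prime has its base at most sqrt n and its exponent at most
  log n to base 2; it remains to count the pairs.\<close>

lemma Ppow_le:
  assumes "2 \<le> n"
  shows "real (Ppow n) \<le> real (card {p. prime p \<and> p \<le> n}) + sqrt (real n) * (ln (real n) / ln 2)"
proof -
  let ?P = "{p. prime p \<and> p \<le> n}" and ?I = "{1..nat \<lfloor>sqrt (real n)\<rfloor>} \<times> {1..nat \<lfloor>log 2 (real n)\<rfloor>}"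
  have "{q. q \<le> n \<and> primepow q} \<subseteq> ?P \<union> (\<lambda>(p, k). p ^ k) ` ?I"
  proof
    fix q assume q: "q \<in> {q. q \<le> n \<and> primepow q}"
    then obtain p k where pk: "prime p" "0 < k" "q = p ^ k" by (auto simp: primepow_def)
    show "q \<in> ?P \<union> (\<lambda>(p, k). p ^ k) ` ?I"
    proof (cases "k = 1")
      case True
      then show ?thesis using q pk by simp
    next
      case False
      have "p \<ge> 2" using pk(1) by (rule prime_ge_2_nat)
      have "p ^ 2 \<le> p ^ k" using False pk(2) \<open>p \<ge> 2\<close> by (intro power_increasing) auto
      then have "p ^ 2 \<le> n" using q pk by simp
      then have "(real p)^2 \<le> real n" by (metis of_nat_le_iff of_nat_power)
      then have 1: "real p \<le> sqrt (real n)" by (rule real_le_rsqrt)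
      have "(2::nat) ^ k \<le> p ^ k" using \<open>p \<ge> 2\<close> by (rule power_mono) simp
      then have "2 ^ k \<le> n" using q pk(3) by auto
      then have "2 ^ k \<le> real n" by (metis of_nat_le_iff of_nat_power of_nat_numeral)
      then have 2: "real k \<le> log 2 (real n)" using assms by (simp add: le_log_iff powr_realpow)
      have "(p, k) \<in> ?I" using 1 2 pk(2) \<open>p \<ge> 2\<close> by (auto simp: le_nat_floor)
      then show ?thesis using pk(3) by force
    qed
  qed
  then have "Ppow n \<le> card (?P \<union> (\<lambda>(p, k). p ^ k) ` ?I)"
    unfolding Ppow_def by (intro card_mono) auto
  also have "\<dots> \<le> card ?P + card ((\<lambda>(p, k). p ^ k) ` ?I)" by (rule card_Un_le)
  also have "card ((\<lambda>(p, k). p ^ k) ` ?I) \<le> card ?I" by (rule card_image_le) simp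
  finally have "Ppow n \<le> card ?P + nat \<lfloor>sqrt (real n)\<rfloor> * nat \<lfloor>log 2 (real n)\<rfloor>"
    by (simp add: card_cartesian_product)
  then have "real (Ppow n) \<le> real (card ?P) + real (nat \<lfloor>sqrt (real n)\<rfloor>) * real (nat \<lfloor>log 2 (real n)\<rfloor>)"
    by (metis of_nat_add of_nat_le_iff of_nat_mult)
  moreover have "real (nat \<lfloor>sqrt (real n)\<rfloor>) * real (nat \<lfloor>log 2 (real n)\<rfloor>) \<le> sqrt (real n) * log 2 (real n)"
    using assms by (intro mult_mono) (auto simp: zero_le_log_cancel_iff)
  ultimately show ?thesis by (simp add: log_def)
qed

text \<open>The factor 2 exceeds 1 / ln 2, and the gap between 1.252 / 0.998 and 1.25506 absorbs
  n^0.998 and the constants.\<close>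

lemma eventually_Ppow_less:
  "\<forall>\<^sub>F m in sequentially. real (2 + Ppow (m - 1)) < 2 * sqrt (real m - 1) * ln (real m - 1)
      + 1.25506 * (real m - 1) / ln (real m - 1)"
proof -
  obtain D where D: "\<And>n. theta n \<le> 1.252 * real n + D" using theta_bound by blast
  let ?f = "\<lambda>n::nat. 2 * sqrt (real n) * ln (real n) + 1.25506 * real n / ln (real n)"
  have "\<forall>\<^sub>F n in sequentially. 2 + real n powr (998/1000) + (1.252 * real n + D) / (998/1000 * ln (real n))
      + sqrt (real n) * (ln (real n) / ln 2) < ?f n"
    by real_asymp
  then have "\<forall>\<^sub>F n in sequentially. real (2 + Ppow n) < ?f n"
    using eventually_ge_at_top[of 2]
  proof eventually_elim
    case (elim n)
    have "0 < ln (real n)" using elim(2) by simp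
    then have "theta n / (998/1000 * ln (real n)) \<le> (1.252 * real n + D) / (998/1000 * ln (real n))"
      using D[of n] by (intro divide_right_mono) auto
    then show ?case using elim(1) card_primes_le[OF elim(2)] Ppow_le[OF elim(2)] by simp
  qed
  then have "\<forall>\<^sub>F n in sequentially. real (2 + Ppow (Suc n - 1)) < 2 * sqrt (real (Suc n) - 1) * ln (real (Suc n) - 1)
      + 1.25506 * (real (Suc n) - 1) / ln (real (Suc n) - 1)"
    by simp
  \<comment> \<open>The estimate was obtained for \<open>n = m - 1\<close>.\<close>
  then show ?thesis by (subst eventually_sequentially_Suc[symmetric])
qed

theorem mainTheorem12:
  shows "(\<forall>z::enat. z \<ge> 1 \<longrightarrow>
            TD (Sig z) (NC_m z 1) = 0 \<and> PBTD (Sig z) (NC_m z 1) = 0)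
    \<and> (\<exists>c1 c2 :: real. c1 > 0 \<and> c2 > 0 \<and> (\<forall>\<^sub>F m in sequentially.
            \<exists>t. TD (Sig 1) (NC_m 1 m) = enat t \<and> c1 * real m \<le> real t \<and> real t \<le> c2 * real m))
    \<and> (\<exists>c1 c2 :: real. c1 > 0 \<and> c2 > 0 \<and> (\<forall>\<^sub>F m in sequentially.
            \<exists>t. PBTD (Sig 1) (NC_m 1 m) = enat t \<and> c1 * real m \<le> real t \<and> real t \<le> c2 * real m))
    \<and> (\<forall>(z::enat) (m::nat). z \<ge> 2 \<longrightarrow> m \<ge> 2 \<longrightarrow>
            enat (Max (omega ` {..m})) \<le> TD (Sig z) (NC_m z m)
          \<and> TD (Sig z) (NC_m z m) \<le> enat (2 + Ppow (m - 1))
          \<and> PBTD (Sig z) (NC_m z m) = 1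
          \<and> PBTD (Sig z) (NC_all z) = 1)
    \<and> (\<forall>z::enat. z \<ge> 2 \<longrightarrow> (\<exists>C::real. \<forall>\<^sub>F m in sequentially.
            \<exists>t. TD (Sig z) (NC_m z m) = enat t \<and>
              real t < C * sqrt (real m - 1) * ln (real m - 1)
                       + 1.25506 * (real m - 1) / ln (real m - 1)))"
proof (intro conjI allI impI)
  fix z :: enat
  show "TD (Sig z) (NC_m z 1) = 0" by (rule TD_NC_m_one)
  then show "PBTD (Sig z) (NC_m z 1) = 0" using PBTD_le_TD[of "Sig z" "NC_m z 1"] by simp
next
  show "\<exists>c1 c2 :: real. c1 > 0 \<and> c2 > 0 \<and> (\<forall>\<^sub>F m in sequentially.
      \<exists>t. TD (Sig 1) (NC_m 1 m) = enat t \<and> c1 * real m \<le> real t \<and> real t \<le> c2 * real m)"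
    by (rule Theta_linear_unary) (simp_all add: PBTD_le_TD)
  show "\<exists>c1 c2 :: real. c1 > 0 \<and> c2 > 0 \<and> (\<forall>\<^sub>F m in sequentially.
      \<exists>t. PBTD (Sig 1) (NC_m 1 m) = enat t \<and> c1 * real m \<le> real t \<and> real t \<le> c2 * real m)"
    by (rule Theta_linear_unary) (simp_all add: PBTD_le_TD)
next
  fix z :: enat and m :: nat assume z: "2 \<le> z" and m: "2 \<le> m"
  have "0 \<in> Sig z" using Sig_ge_two[OF z] by simp
  have "Max (omega ` {..m}) \<in> omega ` {..m}" by (intro Max_in) auto
  then obtain n where "n \<le> m" "Max (omega ` {..m}) = omega n" by blast
  then show "enat (Max (omega ` {..m})) \<le> TD (Sig z) (NC_m z m)"
    using TD_NC_m_ge_omega[OF \<open>0 \<in> Sig z\<close>] by simp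
  show "TD (Sig z) (NC_m z m) \<le> enat (2 + Ppow (m - 1))" using z m by (rule TD_NC_m_le)
  show "PBTD (Sig z) (NC_m z m) = 1" "PBTD (Sig z) (NC_all z) = 1"
    using PBTD_eq_one[OF z m] NC_m_subset_NC_all by blast+
next
  fix z :: enat assume z: "2 \<le> z"
  have "\<forall>\<^sub>F m in sequentially. \<exists>t. TD (Sig z) (NC_m z m) = enat t \<and>
      real t < 2 * sqrt (real m - 1) * ln (real m - 1) + 1.25506 * (real m - 1) / ln (real m - 1)"
    using eventually_Ppow_less eventually_ge_at_top[of 2]
  proof eventually_elim
    case (elim m)
    have le: "TD (Sig z) (NC_m z m) \<le> enat (2 + Ppow (m - 1))" using z elim(2) by (rule TD_NC_m_le)
    then obtain t where t: "TD (Sig z) (NC_m z m) = enat t" by (cases "TD (Sig z) (NC_m z m)") auto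
    then have "real t \<le> real (2 + Ppow (m - 1))" using le by simp
    then show ?case using elim(1) t by auto
  qed
  then show "\<exists>C::real. \<forall>\<^sub>F m in sequentially. \<exists>t. TD (Sig z) (NC_m z m) = enat t \<and>
      real t < C * sqrt (real m - 1) * ln (real m - 1) + 1.25506 * (real m - 1) / ln (real m - 1)"
    by blast
qed

end
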